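(* Let $0 < L < \infty$, $\Omega := (-L, L) \subset \mathbb{R}$, $H := L^2(\Omega)$ and $V := H^1(\Omega)$. Let $\alpha \in V$ and $\beta \in V$ be fixed functions such that $\min_{\overline{\Omega}} \alpha \geq 0$ and $\min_{\overline{\Omega}} \beta > 0$. Define convex functions $V_\alpha, W_\beta, \Phi_{\alpha,\beta} : H \to [0,\infty]$ by $$V_\alpha(\theta) := \sup\left\{ \int_\Omega \theta\, \partial_x \varphi \, dx \ \Big|\ \varphi \in V \cap C_{\mathrm{c}}(\Omega),\ |\varphi| \leq \alpha \text{ on } \overline{\Omega} \right\},$$ $$W_\beta(\theta) := \begin{cases} \displaystyle \frac{1}{2}\int_\Omega \beta\, |\partial_x \theta|^2 \, dx, & \text{if } \theta \in V, \\ \infty, & \text{otherwise,} \end{cases}$$ $$\Phi_{\alpha,\beta}(\theta) := V_\alpha(\theta) + W_\beta(\theta), \qquad \theta \in H.$$ Then the subdifferential $\partial \Phi_{\alpha,\beta} \subset H \times H$ is decomposed as $$\partial \Phi_{\alpha,\beta} = \partial V_\alpha + \partial W_\beta \quad \text{in } H \times H,$$ i.e. $\partial \Phi_{\alpha,\beta}$ is the sum of the subdifferentials $\partial V_\alpha \subset H \times H$ and $\partial W_\beta \subset H \times H$ of the respective convex functions $V_\alpha$ and $W_\beta$.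
   Context: $\partial_x$ denotes the distributional spatial derivative, and $C_{\mathrm{c}}(\Omega)$ the continuous functions on $\Omega$ with compact support in $\Omega$. Elements of $V = H^1(\Omega)$ are identified with their continuous representatives ($V \subset C(\overline{\Omega})$), so pointwise conditions on $\overline{\Omega}$ are meaningful. For a proper, lower semi-continuous, convex function $\Psi : H \to (-\infty, \infty]$, the subdifferential $\partial \Psi$ is the set-valued operator with $z_0^* \in \partial \Psi(z_0)$ if and only if $\Psi(z_0) < \infty$ and $(z_0^*, z - z_0)_H \leq \Psi(z) - \Psi(z_0)$ for all $z \in H$ with $\Psi(z) < \infty$; here $(\cdot,\cdot)_H$ is the $L^2(\Omega)$ inner product. The operator $\partial \Psi$ is identified with its graph $\{[z_0, z_0^*] \in H \times H \mid z_0^* \in \partial \Psi(z_0)\}$. The sum of two set-valued operators $A, B$ on $H$ is the operator $(A+B)(z) := \{a + b \mid a \in A(z),\ b \in B(z)\}$ (empty if $A(z)$ or $B(z)$ is empty), and equality "in $H \times H$" means equality of graphs. *)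

theory Defs
  imports "HOL-Analysis.Analysis"
begin

text \<open>
  Elements of \<open>H = L\<^sup>2(\<Omega>)\<close> are represented by square-integrable functions
  \<open>real \<Rightarrow> real\<close> rather than by classes modulo a.e. equality; values outside \<open>\<Omega>\<close> are irrelevant.
  All functionals and operators below are invariant under a.e. modification on \<open>\<Omega>\<close>, so a graph
  in \<open>H \<times> H\<close> is represented by the set of all pairs of representatives, and equality of these
  sets is equality of the graphs.
\<close>

abbreviation Omega :: "real \<Rightarrow> real set" where
  "Omega L \<equiv> {-L<..<L}"

definition L2 :: "real \<Rightarrow> (real \<Rightarrow> real) set" where
  "L2 L = {u. u \<in> borel_measurable (lebesgue_on (Omega L)) \<and>
              integrable (lebesgue_on (Omega L)) (\<lambda>x. (u x)\<^sup>2)}"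

definition L2_inner :: "real \<Rightarrow> (real \<Rightarrow> real) \<Rightarrow> (real \<Rightarrow> real) \<Rightarrow> real" where
  "L2_inner L u v = (LINT x|lebesgue_on (Omega L). u x * v x)"

text \<open>Functions with compact support in \<open>S\<close> are taken to be extended by zero to the whole line.\<close>

definition Cc :: "real set \<Rightarrow> (real \<Rightarrow> real) set" where
  "Cc S = {\<phi>. continuous_on UNIV \<phi> \<and> compact (closure {x. \<phi> x \<noteq> 0}) \<and>
              closure {x. \<phi> x \<noteq> 0} \<subseteq> S}"

definition Cc_smooth :: "real set \<Rightarrow> (real \<Rightarrow> real) set" where
  "Cc_smooth S = {\<phi> \<in> Cc S. \<forall>n x. (deriv ^^ n) \<phi> field_differentiable (at x)}"

definition has_distr_deriv :: "real \<Rightarrow> (real \<Rightarrow> real) \<Rightarrow> (real \<Rightarrow> real) \<Rightarrow> bool" where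
  "has_distr_deriv L u v \<longleftrightarrow>
     (\<forall>\<phi>\<in>Cc_smooth (Omega L).
        (LINT x|lebesgue_on (Omega L). u x * deriv \<phi> x) =
        - (LINT x|lebesgue_on (Omega L). v x * \<phi> x))"

definition H1 :: "real \<Rightarrow> (real \<Rightarrow> real) set" where
  "H1 L = {u \<in> L2 L. \<exists>v\<in>L2 L. has_distr_deriv L u v}"

text \<open>The derivative is unique up to a.e. equality; it is only used under integrals, for \<open>u \<in> H1 L\<close>.\<close>

definition distr_deriv :: "real \<Rightarrow> (real \<Rightarrow> real) \<Rightarrow> real \<Rightarrow> real" where
  "distr_deriv L u = (SOME v. v \<in> L2 L \<and> has_distr_deriv L u v)"

text \<open>The continuous representatives, on the closed interval, of the elements of \<open>H\<^sup>1(\<Omega>)\<close>.\<close>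

definition H1_cont :: "real \<Rightarrow> (real \<Rightarrow> real) set" where
  "H1_cont L = {u \<in> H1 L. continuous_on {-L..L} u}"

definition V_fun :: "real \<Rightarrow> (real \<Rightarrow> real) \<Rightarrow> (real \<Rightarrow> real) \<Rightarrow> ereal" where
  "V_fun L \<alpha> \<theta> =
     (SUP \<phi>\<in>{\<phi> \<in> H1_cont L \<inter> Cc (Omega L). \<forall>x\<in>{-L..L}. \<bar>\<phi> x\<bar> \<le> \<alpha> x}.
        ereal (LINT x|lebesgue_on (Omega L). \<theta> x * distr_deriv L \<phi> x))"

definition W_fun :: "real \<Rightarrow> (real \<Rightarrow> real) \<Rightarrow> (real \<Rightarrow> real) \<Rightarrow> ereal" where
  "W_fun L \<beta> \<theta> =
     (if \<theta> \<in> H1 L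
      then ereal (1 / 2 * (LINT x|lebesgue_on (Omega L). \<beta> x * \<bar>distr_deriv L \<theta> x\<bar>\<^sup>2))
      else \<infinity>)"

definition Phi_fun ::
    "real \<Rightarrow> (real \<Rightarrow> real) \<Rightarrow> (real \<Rightarrow> real) \<Rightarrow> (real \<Rightarrow> real) \<Rightarrow> ereal" where
  "Phi_fun L \<alpha> \<beta> \<theta> = V_fun L \<alpha> \<theta> + W_fun L \<beta> \<theta>"

definition subdifferential ::
    "real \<Rightarrow> ((real \<Rightarrow> real) \<Rightarrow> ereal) \<Rightarrow> ((real \<Rightarrow> real) \<times> (real \<Rightarrow> real)) set" where
  "subdifferential L \<Psi> =
     {(z0, w). z0 \<in> L2 L \<and> w \<in> L2 L \<and> \<Psi> z0 < \<infinity> \<and>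
        (\<forall>z\<in>L2 L. \<Psi> z < \<infinity> \<longrightarrow> ereal (L2_inner L w (\<lambda>x. z x - z0 x)) \<le> \<Psi> z - \<Psi> z0)}"

definition op_sum ::
    "((real \<Rightarrow> real) \<times> (real \<Rightarrow> real)) set \<Rightarrow> ((real \<Rightarrow> real) \<times> (real \<Rightarrow> real)) set \<Rightarrow>
     ((real \<Rightarrow> real) \<times> (real \<Rightarrow> real)) set" where
  "op_sum A B = {(z, \<lambda>x. a x + b x) |z a b. (z, a) \<in> A \<and> (z, b) \<in> B}"

end

theory Submission
  imports Defs
begin

text \<open>
  The inclusion of \<open>\<partial>V\<^sub>\<alpha> + \<partial>W\<^sub>\<beta>\<close> in \<open>\<partial>\<Phi>\<close> is the addition of two subgradient inequalities. For the
  converse, let \<open>w \<in> \<partial>\<Phi>(\<theta>)\<close>. The functional \<open>\<Phi>\<close> does not change when a constant is added to its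
  argument, so \<open>w\<close> has mean zero (\<open>Phi_subdifferential_mean_zero\<close>), and the primitive \<open>U\<close> of \<open>-w\<close>
  that vanishes at one end of the interval vanishes at both.

  If \<open>w = a + b\<close> is to hold with \<open>a \<in> \<partial>V\<^sub>\<alpha>(\<theta>)\<close> and \<open>b \<in> \<partial>W\<^sub>\<beta>(\<theta>)\<close>, then formally \<open>b = -(\<beta> \<theta>')'\<close>
  and \<open>a = -\<sigma>'\<close> with \<open>\<sigma> \<in> \<alpha> Sgn \<theta>'\<close>, hence \<open>U = \<sigma> + \<beta> \<theta>'\<close>. In one dimension this pointwise inclusion
  can be solved for \<open>\<sigma>\<close> without knowing \<open>\<theta>\<close>: since \<open>\<beta> > 0\<close>, \<open>\<sigma>\<close> has to be the truncation of \<open>U\<close> to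
  the interval from \<open>-\<alpha>\<close> to \<open>\<alpha>\<close>. A truncation of an \<open>H\<^sup>1\<close> function by \<open>H\<^sup>1\<close> functions is again in
  \<open>H\<^sup>1\<close> (\<open>primitive_max\<close>, \<open>primitive_min\<close>), which is the regularity that the decomposition needs.
  So define \<open>\<sigma>\<close> in this way, put \<open>g = (U - \<sigma>) / \<beta>\<close>, and let \<open>\<tau>\<close> be a primitive of \<open>g\<close>.

  It remains to identify \<open>\<theta>'\<close> with \<open>g\<close>. This uses the upper bound
  \<open>V\<^sub>\<alpha>(z) \<le> \<integral> \<alpha> |z'|\<close> for \<open>z \<in> H\<^sup>1\<close> (\<open>V_fun_le\<close>), and the lower
  bound \<open>V\<^sub>\<alpha>(z) \<ge> -\<integral> z \<sigma>'\<close> for \<open>z \<in> L\<^sup>2\<close> (\<open>V_fun_ge\<close>), where \<open>\<sigma>\<close> only vanishes at the end points and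
  has to be approximated by functions with compact support. Since \<open>\<sigma> g = \<alpha> |g|\<close>, inserting
  \<open>\<tau>\<close> into the subgradient inequality of \<open>w\<close> at \<open>\<theta>\<close> leaves \<open>\<integral> \<beta> (\<theta>' - g)\<^sup>2 / 2 \<le> 0\<close>.
  Thus \<open>\<theta>' = g\<close> almost everywhere. The same two estimates then show that \<open>a = -\<sigma>'\<close> is a subgradient
  of \<open>V\<^sub>\<alpha>\<close> at \<open>\<theta>\<close>, and \<open>b = w + \<sigma>' = -(\<beta> \<theta>')'\<close> is one of \<open>W\<^sub>\<beta>\<close> by integration by parts and the
  convexity of the square.

  All the calculus is carried out with primitives of Lebesgue integrable functions. The one
  analytic tool is a chain rule for \<open>C\<^sup>1\<close> outer functions (\<open>primitive_comp\<close>); the product rule,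
  the derivative of an absolute value and the vanishing of the derivative on the zero set are
  instances or limits of it. The passage from distributional derivatives to primitives is the lemma
  of du Bois-Reymond (\<open>du_Bois_Reymond\<close>), which in turn needs an explicit supply of smooth bump
  functions.
\<close>

section \<open>Primitives of integrable functions\<close>

text \<open>
  For real functions on a compact interval this is absolute continuity of \<open>u\<close> together with the
  name \<open>v\<close> of its derivative. It is stated for pairs of points and not relative to the left end
  point, so that it restricts to subintervals and can be unfolded by rewriting.
\<close>

definition primitive_on :: "real \<Rightarrow> real \<Rightarrow> (real \<Rightarrow> real) \<Rightarrow> (real \<Rightarrow> real) \<Rightarrow> bool" where
  "primitive_on a b u v \<longleftrightarrow> v absolutely_integrable_on {a..b} \<and>
     (\<forall>x y. a \<le> x \<longrightarrow> x \<le> y \<longrightarrow> y \<le> b \<longrightarrow> u y - u x = integral {x..y} v)"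

lemma primitive_absolutely_integrable: "primitive_on a b u v \<Longrightarrow> v absolutely_integrable_on {a..b}"
  by (simp add: primitive_on_def)

lemma primitive_diff:
  "primitive_on a b u v \<Longrightarrow> a \<le> x \<Longrightarrow> x \<le> y \<Longrightarrow> y \<le> b \<Longrightarrow> u y - u x = integral {x..y} v"
  by (simp add: primitive_on_def)

lemma primitive_base: "primitive_on a b u v \<Longrightarrow> y \<in> {a..b} \<Longrightarrow> u y = u a + integral {a..y} v"
  using primitive_diff[of a b u v a y] by simp

lemma absolutely_integrable_imp_integrable_sub:
  fixes v :: "real \<Rightarrow> real" and a b x y :: real
  assumes "v absolutely_integrable_on {a..b}" "a \<le> x" "y \<le> b"
  shows "v integrable_on {x..y}"
  using assms by (meson absolutely_integrable_on_def atLeastatMost_subset_iff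
      integrable_on_subinterval)

lemma primitive_onI:
  assumes v: "v absolutely_integrable_on {a..b}"
    and u: "\<And>y. y \<in> {a..b} \<Longrightarrow> u y = c + integral {a..y} v"
  shows "primitive_on a b u v"
  unfolding primitive_on_def
proof (intro conjI v allI impI)
  fix x y assume xy: "a \<le> x" "x \<le> y" "y \<le> b"
  have "integral {a..x} v + integral {x..y} v = integral {a..y} v"
    using xy by (intro Henstock_Kurzweil_Integration.integral_combine absolutely_integrable_imp_integrable_sub[OF v]) auto
  thus "u y - u x = integral {x..y} v" using u[of x] u[of y] xy by simp
qed

lemma primitive_continuous_on: "primitive_on a b u v \<Longrightarrow> continuous_on {a..b} u"
proof -
  assume p: "primitive_on a b u v"
  hence "v integrable_on {a..b}"
    by (simp add: primitive_on_def absolutely_integrable_on_def)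
  hence "continuous_on {a..b} (\<lambda>x. u a + integral {a..x} v)"
    by (intro continuous_intros indefinite_integral_continuous_1)
  thus ?thesis
    by (rule continuous_on_eq) (rule primitive_base[OF p, symmetric])
qed

lemma primitive_cong:
  assumes "primitive_on a b u v" "\<And>x. x \<in> {a..b} \<Longrightarrow> u x = u' x" "\<And>x. x \<in> {a..b} \<Longrightarrow> v x = v' x"
  shows "primitive_on a b u' v'"
  unfolding primitive_on_def
proof (intro conjI allI impI)
  show "v' absolutely_integrable_on {a..b}"
    by (rule absolutely_integrable_spike[OF primitive_absolutely_integrable[OF assms(1)], where S = "{}"])
      (use assms(3) in auto)
  fix x y assume xy: "a \<le> x" "x \<le> y" "y \<le> b"
  have "integral {x..y} v = integral {x..y} v'"
    using xy assms(3) by (intro integral_cong) auto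
  thus "u' y - u' x = integral {x..y} v'"
    using primitive_diff[OF assms(1) xy] assms(2)[of x] assms(2)[of y] xy by simp
qed

lemma primitive_const: "primitive_on a b (\<lambda>x. c) (\<lambda>x. 0)"
  by (simp add: primitive_on_def)

lemma primitive_add:
  assumes "primitive_on a b u v" "primitive_on a b p q"
  shows "primitive_on a b (\<lambda>x. u x + p x) (\<lambda>x. v x + q x)"
  unfolding primitive_on_def
proof (intro conjI allI impI)
  show "(\<lambda>x. v x + q x) absolutely_integrable_on {a..b}"
    using assms by (auto simp: primitive_on_def intro: set_integral_add)
  fix x y assume xy: "a \<le> x" "x \<le> y" "y \<le> b"
  have "integral {x..y} (\<lambda>x. v x + q x) = integral {x..y} v + integral {x..y} q"
    using xy assms by (intro Henstock_Kurzweil_Integration.integral_add)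
      (auto intro: absolutely_integrable_imp_integrable_sub primitive_absolutely_integrable)
  thus "u y + p y - (u x + p x) = integral {x..y} (\<lambda>x. v x + q x)"
    using primitive_diff[OF assms(1) xy] primitive_diff[OF assms(2) xy] by simp
qed

lemma primitive_cmult:
  assumes "primitive_on a b u v"
  shows "primitive_on a b (\<lambda>x. c * u x) (\<lambda>x. c * v x)"
  using assms by (auto simp: primitive_on_def simp flip: right_diff_distrib)

lemma primitive_minus:
  assumes "primitive_on a b u v" "primitive_on a b p q"
  shows "primitive_on a b (\<lambda>x. u x - p x) (\<lambda>x. v x - q x)"
  using primitive_add[OF assms(1) primitive_cmult[OF assms(2), of "-1"]] by simp

lemma primitive_continuous_mult:
  assumes "primitive_on a b u v" "continuous_on {a..b} f"
  shows "(\<lambda>x. f x * v x) absolutely_integrable_on {a..b}"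
proof (rule absolutely_integrable_bounded_measurable_product_real)
  show "f \<in> borel_measurable (lebesgue_on {a..b})"
    using assms by (intro continuous_imp_measurable_on_sets_lebesgue) auto
  show "bounded (f ` {a..b})"
    using assms compact_continuous_image compact_imp_bounded by blast
qed (use assms in \<open>auto simp: primitive_on_def\<close>)

text \<open>
  On a short interval around \<open>x\<close>, both the increment of \<open>F \<circ> u\<close> and the integral of \<open>F'(u) v\<close> are
  close to \<open>F'(u x)\<close> times the increment of \<open>u\<close>, with an error of at most \<open>\<epsilon> \<integral> |v|\<close> each. Such an error
  bound is additive over adjacent intervals, so Bolzano's bisection principle makes it global.
\<close>

lemma primitive_comp:
  assumes p: "primitive_on a b u v"
    and F: "\<And>t. (F has_field_derivative F' t) (at t)"
    and F': "continuous_on UNIV F'"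
  shows "primitive_on a b (\<lambda>x. F (u x)) (\<lambda>x. F' (u x) * v x)"
proof -
  let ?f = "\<lambda>x. F' (u x) * v x"
  have cu: "continuous_on {a..b} u" using primitive_continuous_on[OF p] .
  have ai: "?f absolutely_integrable_on {a..b}"
    using continuous_on_compose2[OF F' cu] by (intro primitive_continuous_mult[OF p]) auto
  have va: "v absolutely_integrable_on {a..b}" using p by (simp add: primitive_on_def)
  have main: "F (u y) = F (u a) + integral {a..y} ?f" if y: "y \<in> {a..b}" for y
  proof -
    have sub: "g integrable_on {p..q}" if "a \<le> p" "q \<le> b" "g absolutely_integrable_on {a..b}"
      for p q and g :: "real \<Rightarrow> real"
      using that by (meson absolutely_integrable_on_def atLeastatMost_subset_iff
          integrable_on_subinterval)
    have suba: "(\<lambda>x. \<bar>v x\<bar>) integrable_on {p..q}" if "a \<le> p" "q \<le> b" for p q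
      using sub[OF that, of "\<lambda>x. \<bar>v x\<bar>"] set_integrable_abs[OF va] by simp
    have bd: "\<bar>F (u y) - F (u a) - integral {a..y} ?f\<bar> \<le> 2 * e * integral {a..y} (\<lambda>x. \<bar>v x\<bar>)"
      if e: "e > 0" for e
    proof -
      \<comment> \<open>Bisection: the bound is additive in the interval and holds near each point.\<close>
      let ?P = "\<lambda>p q. a \<le> p \<longrightarrow> q \<le> b \<longrightarrow> \<bar>F (u q) - F (u p) - integral {p..q} ?f\<bar>
                   \<le> 2 * e * integral {p..q} (\<lambda>x. \<bar>v x\<bar>)"
      have "?P a y"
      proof (rule Bolzano[where P = ?P])
        show "a \<le> y" using y by simp
      next
        fix p q r assume h: "?P p q" "?P q r" and "p \<le> q" "q \<le> r"
        show "?P p r"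
        proof (intro impI)
          assume ab: "a \<le> p" "r \<le> b"
          have "integral {p..q} ?f + integral {q..r} ?f = integral {p..r} ?f"
            by (intro Henstock_Kurzweil_Integration.integral_combine \<open>p \<le> q\<close> \<open>q \<le> r\<close> sub ab ai)
          moreover have "integral {p..q} (\<lambda>x. \<bar>v x\<bar>) + integral {q..r} (\<lambda>x. \<bar>v x\<bar>)
              = integral {p..r} (\<lambda>x. \<bar>v x\<bar>)"
            by (intro Henstock_Kurzweil_Integration.integral_combine \<open>p \<le> q\<close> \<open>q \<le> r\<close> suba ab)
          moreover note h
          ultimately show "\<bar>F (u r) - F (u p) - integral {p..r} ?f\<bar>
                   \<le> 2 * e * integral {p..r} (\<lambda>x. \<bar>v x\<bar>)"
            using ab \<open>p \<le> q\<close> \<open>q \<le> r\<close> distrib_left[of "2 * e" "integral {p..q} (\<lambda>x. \<bar>v x\<bar>)"]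
            by (smt (verit))
        qed
      next
        fix x assume x: "a \<le> x" "x \<le> y"
        have xab: "x \<in> {a..b}" using x y by auto
        define c where "c = F' (u x)"
        obtain \<eta> where \<eta>: "\<eta> > 0" "\<And>r. \<bar>r - u x\<bar> < \<eta> \<Longrightarrow> \<bar>F' r - c\<bar> < e"
          using F' e unfolding continuous_on_iff dist_real_def c_def by (metis UNIV_I)
        obtain \<delta> where \<delta>: "\<delta> > 0" "\<And>t. t \<in> {a..b} \<Longrightarrow> \<bar>t - x\<bar> < \<delta> \<Longrightarrow> \<bar>u t - u x\<bar> < \<eta>"
          using cu \<eta>(1) xab unfolding continuous_on_iff dist_real_def by metis
        show "\<exists>d>0. \<forall>p q. p \<le> x \<and> x \<le> q \<and> q - p < d \<longrightarrow> ?P p q"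
        proof (intro exI conjI allI impI)
          show "\<delta> > 0" by fact
        next
          fix p q assume pq: "p \<le> x \<and> x \<le> q \<and> q - p < \<delta>" and ab: "a \<le> p" "q \<le> b"
          let ?I = "integral {p..q} (\<lambda>x. \<bar>v x\<bar>)"
          have up: "u q - u p = integral {p..q} v"
            using primitive_diff[OF p ab(1) _ ab(2)] pq by simp
          have "\<bar>integral {p..q} v\<bar> \<le> ?I"
            using integral_norm_bound_integral[OF sub[OF ab va] suba[OF ab]] by simp
          hence le1: "\<bar>u q - u p\<bar> \<le> ?I" using up by simp
          have "norm ((F (u q) - c * u q) - (F (u p) - c * u p)) \<le> e * norm (u q - u p)"
          proof (rule field_differentiable_bound[where S = "ball (u x) \<eta>" and f' = "\<lambda>t. F' t - c"])
            show "((\<lambda>t. F t - c * t) has_field_derivative F' t - c) (at t within ball (u x) \<eta>)" for t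
              by (auto intro!: derivative_eq_intros has_field_derivative_at_within[OF F])
            show "norm (F' t - c) \<le> e" if "t \<in> ball (u x) \<eta>" for t
              using \<eta>(2)[of t] that by (auto simp: dist_real_def abs_minus_commute)
            show "u q \<in> ball (u x) \<eta>"
              using \<delta>(2)[of q] pq ab by (auto simp: dist_real_def abs_minus_commute)
            show "u p \<in> ball (u x) \<eta>"
              using \<delta>(2)[of p] pq ab by (auto simp: dist_real_def abs_minus_commute)
          qed auto
          also have "\<dots> \<le> e * ?I" using le1 e by simp
          finally have b1: "\<bar>F (u q) - F (u p) - c * (u q - u p)\<bar> \<le> e * ?I"
            by (simp add: algebra_simps)
          have i1: "?f integrable_on {p..q}" using sub[OF ab ai] .
          have i2: "(\<lambda>t. c * v t) integrable_on {p..q}"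
            using sub[OF ab va] by (simp add: integrable_on_mult_right)
          have "norm (integral {p..q} (\<lambda>t. ?f t - c * v t)) \<le> integral {p..q} (\<lambda>t. e * \<bar>v t\<bar>)"
          proof (rule integral_norm_bound_integral)
            show "(\<lambda>t. ?f t - c * v t) integrable_on {p..q}" using i1 i2 by (rule integrable_diff)
            show "(\<lambda>t. e * \<bar>v t\<bar>) integrable_on {p..q}"
              using suba[OF ab] by (simp add: integrable_on_mult_right)
            fix t assume t: "t \<in> {p..q}"
            have "\<bar>F' (u t) - c\<bar> \<le> e"
              using \<eta>(2)[of "u t"] \<delta>(2)[of t] t pq ab by force
            hence "\<bar>F' (u t) - c\<bar> * \<bar>v t\<bar> \<le> e * \<bar>v t\<bar>" by (rule mult_right_mono) simp
            thus "norm (?f t - c * v t) \<le> e * \<bar>v t\<bar>"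
              by (simp add: abs_mult flip: left_diff_distrib)
          qed
          hence "\<bar>integral {p..q} ?f - c * integral {p..q} v\<bar> \<le> e * ?I"
            using Henstock_Kurzweil_Integration.integral_diff[OF i1 i2] by simp
          thus "\<bar>F (u q) - F (u p) - integral {p..q} ?f\<bar> \<le> 2 * e * ?I"
            using b1 up by (simp add: algebra_simps)
        qed
      qed
      thus ?thesis using y by simp
    qed
    let ?J = "integral {a..y} (\<lambda>x. \<bar>v x\<bar>)"
    have J: "?J \<ge> 0" by (rule integral_nonneg) (use suba[of a y] y in auto)
    have "\<bar>F (u y) - F (u a) - integral {a..y} ?f\<bar> \<le> 0 + e" if "e > 0" for e
    proof -
      \<comment> \<open>The summand 1 keeps the denominator positive when the integral vanishes.\<close>
      have "2 * (e / (2 * (?J + 1))) * ?J \<le> e"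
        using J that by (simp add: field_simps)
      thus ?thesis using bd[of "e / (2 * (?J + 1))"] J that by (smt (verit) divide_pos_pos)
    qed
    hence "\<bar>F (u y) - F (u a) - integral {a..y} ?f\<bar> \<le> 0" by (rule field_le_epsilon)
    thus ?thesis by simp
  qed
  show ?thesis by (rule primitive_onI[OF ai main])
qed

lemma primitive_mult:
  assumes "primitive_on a b u v" "primitive_on a b p q"
  shows "primitive_on a b (\<lambda>x. u x * p x) (\<lambda>x. u x * q x + v x * p x)"
proof -
  have sq: "primitive_on a b (\<lambda>x. (f x)\<^sup>2) (\<lambda>x. 2 * f x * g x)" if "primitive_on a b f g" for f g
  proof (rule primitive_comp[OF that, of "\<lambda>t. t\<^sup>2" "\<lambda>t. 2 * t"])
    show "((\<lambda>t. t\<^sup>2) has_field_derivative 2 * t) (at t)" for t :: real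
      by (auto intro!: derivative_eq_intros)
    show "continuous_on UNIV ((*) (2::real))" by (intro continuous_intros)
  qed
  \<comment> \<open>Polarisation of the chain rule for the square.\<close>
  note primitive_cmult[OF primitive_minus[OF sq[OF primitive_add[OF assms]] sq[OF primitive_minus[OF assms]]], of "1/4"]
  thus ?thesis
    by (rule primitive_cong) (simp_all add: power2_eq_square field_simps)
qed

lemma primitive_by_parts:
  assumes "primitive_on a b u v" "primitive_on a b p q" "a \<le> b"
  shows "(\<lambda>x. u x * q x) absolutely_integrable_on {a..b}"
    and "(\<lambda>x. v x * p x) absolutely_integrable_on {a..b}"
    and "integral {a..b} (\<lambda>x. u x * q x)
       = u b * p b - u a * p a - integral {a..b} (\<lambda>x. v x * p x)"
proof -
  show 1: "(\<lambda>x. u x * q x) absolutely_integrable_on {a..b}"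
    by (rule primitive_continuous_mult[OF assms(2) primitive_continuous_on[OF assms(1)]])
  show 2: "(\<lambda>x. v x * p x) absolutely_integrable_on {a..b}"
    using primitive_continuous_mult[OF assms(1) primitive_continuous_on[OF assms(2)]]
    by (simp add: mult.commute)
  have "u b * p b - u a * p a = integral {a..b} (\<lambda>x. u x * q x + v x * p x)"
    using primitive_diff[OF primitive_mult[OF assms(1,2)]] assms(3) by simp
  also have "\<dots> = integral {a..b} (\<lambda>x. u x * q x) + integral {a..b} (\<lambda>x. v x * p x)"
    using 1 2 by (intro Henstock_Kurzweil_Integration.integral_add)
      (auto simp: absolutely_integrable_on_def)
  finally show "integral {a..b} (\<lambda>x. u x * q x)
       = u b * p b - u a * p a - integral {a..b} (\<lambda>x. v x * p x)" by simp
qed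

text \<open>
  Dominated convergence in the chain rule; this extends it to outer functions with a kink, for which
  \<open>G'\<close> is discontinuous and fixes a value of the derivative at the kink.
\<close>

lemma primitive_comp_limit:
  fixes F F' :: "nat \<Rightarrow> real \<Rightarrow> real"
  assumes p: "primitive_on a b u v"
    and F: "\<And>k t. (F k has_field_derivative F' k t) (at t)"
    and F': "\<And>k. continuous_on UNIV (F' k)"
    and bd: "\<And>k t. \<bar>F' k t\<bar> \<le> 1"
    and lim: "\<And>t. (\<lambda>k. F k t) \<longlonglongrightarrow> G t" and lim': "\<And>t. (\<lambda>k. F' k t) \<longlonglongrightarrow> G' t"
  shows "primitive_on a b (\<lambda>x. G (u x)) (\<lambda>x. G' (u x) * v x)"
proof (cases "a \<le> b")
  case True
  have pk: "primitive_on a b (\<lambda>x. F k (u x)) (\<lambda>x. F' k (u x) * v x)" for k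
    by (rule primitive_comp[OF p, of "F k" "F' k", OF F F'])
  have va: "v absolutely_integrable_on {a..b}" using p by (simp add: primitive_on_def)
  have dom: "norm (F' k (u x) * v x) \<le> \<bar>v x\<bar>" for k x
    using mult_right_mono[OF bd[of k "u x"], of "\<bar>v x\<bar>"] by (simp add: abs_mult)
  have conv: "(\<lambda>x. G' (u x) * v x) integrable_on {a..y} \<and>
     (\<lambda>k. integral {a..y} (\<lambda>x. F' k (u x) * v x)) \<longlonglongrightarrow> integral {a..y} (\<lambda>x. G' (u x) * v x)"
    if "y \<in> {a..b}" for y
  proof -
    have "(\<lambda>x. \<bar>v x\<bar>) absolutely_integrable_on {a..b}" using set_integrable_abs[OF va] by simp
    hence "(\<lambda>x. \<bar>v x\<bar>) integrable_on {a..y}"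
      by (meson absolutely_integrable_on_def atLeastatMost_subset_iff that
          integrable_on_subinterval order_refl atLeastAtMost_iff)
    moreover have "(\<lambda>x. F' k (u x) * v x) integrable_on {a..y}" for k
      using primitive_absolutely_integrable[OF pk] that
      by (meson absolutely_integrable_on_def atLeastatMost_subset_iff
          integrable_on_subinterval order_refl atLeastAtMost_iff)
    moreover have "(\<lambda>k. F' k (u x) * v x) \<longlonglongrightarrow> G' (u x) * v x" for x
      by (rule tendsto_mult[OF lim' tendsto_const])
    ultimately show ?thesis
      using dominated_convergence[of "\<lambda>k x. F' k (u x) * v x" "{a..y}" "\<lambda>x. \<bar>v x\<bar>" "\<lambda>x. G' (u x) * v x"] dom
      by blast
  qed
  have G1: "\<bar>G' t\<bar> \<le> 1" for t
    by (rule LIMSEQ_le_const2[OF tendsto_rabs[OF lim']]) (use bd in auto)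
  have "(\<lambda>x. G' (u x) * v x) absolutely_integrable_on {a..b}"
  proof (rule absolutely_integrable_integrable_bound)
    show "norm (G' (u x) * v x) \<le> \<bar>v x\<bar>" for x
      using mult_right_mono[OF G1[of "u x"], of "\<bar>v x\<bar>"] by (simp add: abs_mult)
    show "(\<lambda>x. \<bar>v x\<bar>) integrable_on {a..b}" using va
      by (simp add: absolutely_integrable_on_def)
  qed (use conv True in auto)
  moreover have "G (u y) = G (u a) + integral {a..y} (\<lambda>x. G' (u x) * v x)" if y: "y \<in> {a..b}" for y
  proof (rule LIMSEQ_unique)
    show "(\<lambda>k. F k (u y)) \<longlonglongrightarrow> G (u y)" by (rule lim)
    have "(\<lambda>k. F k (u a) + integral {a..y} (\<lambda>x. F' k (u x) * v x))
       \<longlonglongrightarrow> G (u a) + integral {a..y} (\<lambda>x. G' (u x) * v x)"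
      using conv[OF y] by (intro tendsto_intros lim) auto
    moreover have "F k (u y) = F k (u a) + integral {a..y} (\<lambda>x. F' k (u x) * v x)" for k
      by (rule primitive_base[OF pk y])
    ultimately show "(\<lambda>k. F k (u y)) \<longlonglongrightarrow> G (u a) + integral {a..y} (\<lambda>x. G' (u x) * v x)"
      by simp
  qed
  ultimately show ?thesis by (rule primitive_onI)
qed (simp add: primitive_on_def)

text \<open>
  Approximation of \<open>|t|\<close> by \<open>sqrt (t\<^sup>2 + \<epsilon>\<^sup>2)\<close>, whose derivative tends to \<open>sgn t\<close> also at \<open>0\<close>.
\<close>

lemma primitive_abs:
  assumes "primitive_on a b u v"
  shows "primitive_on a b (\<lambda>x. \<bar>u x\<bar>) (\<lambda>x. sgn (u x) * v x)"
proof (rule primitive_comp_limit[OF assms])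
  define e where "e = (\<lambda>k::nat. 1 / real (Suc k))"
  have epos: "e k > 0" for k by (simp add: e_def)
  have spos: "t\<^sup>2 + (e k)\<^sup>2 > 0" for k t using epos[of k] by (simp add: add_nonneg_pos)
  have elim: "e \<longlonglongrightarrow> 0" unfolding e_def
    using LIMSEQ_inverse_real_of_nat by (simp add: inverse_eq_divide)
  show "((\<lambda>t. sqrt (t\<^sup>2 + (e k)\<^sup>2)) has_field_derivative t / sqrt (t\<^sup>2 + (e k)\<^sup>2)) (at t)" for k t
    using spos[of t k] by (auto intro!: derivative_eq_intros simp: field_simps)
  show "continuous_on UNIV (\<lambda>t. t / sqrt (t\<^sup>2 + (e k)\<^sup>2))" for k
    using spos by (intro continuous_intros) (metis less_irrefl real_sqrt_eq_zero_cancel_iff)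
  show "\<bar>t / sqrt (t\<^sup>2 + (e k)\<^sup>2)\<bar> \<le> 1" for k t
  proof -
    have "\<bar>t\<bar> \<le> sqrt (t\<^sup>2 + (e k)\<^sup>2)" by (rule real_le_rsqrt) simp
    thus ?thesis using spos[of t k] by (simp add: abs_divide)
  qed
  have lim: "(\<lambda>k. sqrt (t\<^sup>2 + (e k)\<^sup>2)) \<longlonglongrightarrow> \<bar>t\<bar>" for t
    using tendsto_real_sqrt[OF tendsto_add[OF tendsto_const tendsto_power[OF elim, of 2]], of "t\<^sup>2"]
    by simp
  thus "(\<lambda>k. sqrt (t\<^sup>2 + (e k)\<^sup>2)) \<longlonglongrightarrow> \<bar>t\<bar>" for t .
  show "(\<lambda>k. t / sqrt (t\<^sup>2 + (e k)\<^sup>2)) \<longlonglongrightarrow> sgn t" for t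
  proof (cases "t = 0")
    case False
    have "(\<lambda>k. t / sqrt (t\<^sup>2 + (e k)\<^sup>2)) \<longlonglongrightarrow> t / \<bar>t\<bar>"
      by (intro tendsto_intros lim) (use False in auto)
    thus ?thesis by (simp add: real_sgn_eq)
  qed simp
qed

text \<open>
  The functions \<open>\<epsilon> arctan (t / \<epsilon>)\<close> tend to \<open>0\<close>, but their derivatives tend to the indicator of
  \<open>{0}\<close>. The limit of the chain rule therefore says that the derivative of \<open>u\<close>, restricted to the
  zero set of \<open>u\<close>, integrates to \<open>0\<close> over every interval.
\<close>

lemma primitive_zero_set:
  assumes "primitive_on a b u v"
  shows "primitive_on a b (\<lambda>x. 0) (\<lambda>x. if u x = 0 then v x else 0)"
proof -
  have "primitive_on a b (\<lambda>x. 0) (\<lambda>x. (if u x = 0 then 1 else 0) * v x)"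
  proof (rule primitive_comp_limit[OF assms, where G = "\<lambda>_. 0" and G' = "\<lambda>t. if t = 0 then 1 else 0"])
    define n where "n = (\<lambda>k::nat. real (Suc k))"
    have npos: "n k > 0" for k by (simp add: n_def)
    have elim: "(\<lambda>k. 1 / n k) \<longlonglongrightarrow> 0" unfolding n_def
      using LIMSEQ_inverse_real_of_nat by (simp add: inverse_eq_divide)
    have den: "1 + (n k * t)\<^sup>2 > 0" for k t by (simp add: add_pos_nonneg)
    show "((\<lambda>t. 1 / n k * arctan (n k * t)) has_field_derivative 1 / (1 + (n k * t)\<^sup>2)) (at t)" for k t
    proof -
      have "((\<lambda>t. 1 / n k * arctan (n k * t)) has_field_derivative
          1 / n k * (inverse (1 + (n k * t)\<^sup>2) * n k)) (at t)"
        by (intro DERIV_cmult DERIV_chain2[OF DERIV_arctan]) (auto intro!: derivative_eq_intros)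
      thus ?thesis using npos[of k] by (simp add: inverse_eq_divide)
    qed
    show "continuous_on UNIV (\<lambda>t. 1 / (1 + (n k * t)\<^sup>2))" for k
      using den by (intro continuous_intros) (metis less_irrefl)
    show "\<bar>1 / (1 + (n k * t)\<^sup>2)\<bar> \<le> 1" for k t using den[of k t] by simp
    show "(\<lambda>k. 1 / n k * arctan (n k * t)) \<longlonglongrightarrow> 0" for t
    proof (rule Lim_null_comparison)
      show "\<forall>\<^sub>F k in sequentially. norm (1 / n k * arctan (n k * t)) \<le> 2 * (1 / n k)"
      proof (rule always_eventually, rule allI)
        fix k
        have "\<bar>arctan (n k * t)\<bar> \<le> 2"
          using arctan_bounded[of "n k * t"] pi_less_4 by linarith
        thus "norm (1 / n k * arctan (n k * t)) \<le> 2 * (1 / n k)"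
          using npos[of k] by (simp add: abs_mult divide_right_mono)
      qed
      show "(\<lambda>k. 2 * (1 / n k)) \<longlonglongrightarrow> 0" using tendsto_mult[OF tendsto_const elim] by simp
    qed
    show "(\<lambda>k. 1 / (1 + (n k * t)\<^sup>2)) \<longlonglongrightarrow> (if t = 0 then 1 else 0)" for t
    proof (cases "t = 0")
      case False
      have "(\<lambda>k. 1 / (1 + (n k * t)\<^sup>2)) \<longlonglongrightarrow> 0"
      proof (rule Lim_null_comparison)
        show "\<forall>\<^sub>F k in sequentially. norm (1 / (1 + (n k * t)\<^sup>2)) \<le> (1 / t\<^sup>2) * (1 / n k)\<^sup>2"
        proof (intro always_eventually allI)
          fix k
          have "n k * t \<noteq> 0" using npos[of k] False by simp
          hence "1 / (1 + (n k * t)\<^sup>2) \<le> 1 / (n k * t)\<^sup>2" by (intro frac_le) auto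
          thus "norm (1 / (1 + (n k * t)\<^sup>2)) \<le> (1 / t\<^sup>2) * (1 / n k)\<^sup>2"
            by (simp add: power_mult_distrib power_divide mult.commute)
        qed
        show "(\<lambda>k. (1 / t\<^sup>2) * (1 / n k)\<^sup>2) \<longlonglongrightarrow> 0"
          using tendsto_mult[OF tendsto_const tendsto_power[OF elim, of 2], of "1 / t\<^sup>2"] by simp
      qed
      thus ?thesis using False by simp
    qed simp
  qed
  thus ?thesis by (rule primitive_cong) auto
qed

section \<open>Smooth bump functions\<close>

definition smooth :: "(real \<Rightarrow> real) \<Rightarrow> bool" where
  "smooth f \<longleftrightarrow> (\<forall>n x. (deriv ^^ n) f field_differentiable (at x))"

text \<open>
  Smoothness quantifies over iterated derivatives, which are inconvenient to compute. It is enough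
  to find a class of differentiable functions that is closed under differentiation.
\<close>

lemma smooth_coinduct:
  assumes "f \<in> S" and "\<And>g x. g \<in> S \<Longrightarrow> g field_differentiable (at x)"
    and "\<And>g. g \<in> S \<Longrightarrow> deriv g \<in> S"
  shows "smooth f"
proof -
  have "(deriv ^^ n) f \<in> S" for n
    by (induction n) (use assms in auto)
  thus ?thesis using assms(2) by (auto simp: smooth_def)
qed

lemma smooth_differentiable: "smooth f \<Longrightarrow> f field_differentiable (at x)"
  unfolding smooth_def by (metis funpow_0)

lemma smooth_deriv: "smooth f \<Longrightarrow> smooth (deriv f)"
  unfolding smooth_def by (metis comp_apply funpow_Suc_right)

lemma smooth_DERIV: "smooth f \<Longrightarrow> (f has_field_derivative deriv f x) (at x)"
  by (simp add: DERIV_deriv_iff_field_differentiable smooth_differentiable)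

lemma smooth_continuous: "smooth f \<Longrightarrow> continuous_on S f"
  by (meson DERIV_isCont continuous_at_imp_continuous_on smooth_DERIV)

lemma smooth_antideriv:
  assumes "\<And>x. (F has_field_derivative f x) (at x)" "smooth f"
  shows "smooth F"
proof -
  have "deriv F = f" using assms(1) by (auto intro: DERIV_imp_deriv)
  hence "(deriv ^^ Suc n) F = (deriv ^^ n) f" for n by (simp add: funpow_Suc_right del: funpow.simps)
  moreover have "(deriv ^^ 0) F field_differentiable (at x)" for x
    using assms(1) by (auto simp: field_differentiable_def)
  ultimately show ?thesis
    using assms(2) unfolding smooth_def by (metis not0_implies_Suc)
qed

lemma smooth_add: "smooth f \<Longrightarrow> smooth g \<Longrightarrow> smooth (\<lambda>x. f x + g x)"
proof (rule smooth_coinduct[where S = "{\<lambda>x. f x + g x |f g. smooth f \<and> smooth g}"])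
  fix h assume "h \<in> {\<lambda>x. f x + g x |f g. smooth f \<and> smooth g}"
  then obtain f g where h: "h = (\<lambda>x. f x + g x)" "smooth f" "smooth g" by blast
  have d: "(h has_field_derivative deriv f x + deriv g x) (at x)" for x
    unfolding h(1) by (intro DERIV_add smooth_DERIV h)
  thus "h field_differentiable (at x)" for x by (auto simp: field_differentiable_def)
  have "deriv h = (\<lambda>x. deriv f x + deriv g x)"
    using d by (auto intro: DERIV_imp_deriv)
  thus "deriv h \<in> {\<lambda>x. f x + g x |f g. smooth f \<and> smooth g}"
    using h smooth_deriv by blast
qed blast

lemma smooth_affine: "smooth f \<Longrightarrow> smooth (\<lambda>x. k * f (c * x + d))"
proof (rule smooth_coinduct[where S = "{\<lambda>x. k * f (c * x + d) |f k. smooth f}"])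
  fix h assume "h \<in> {\<lambda>x. k * f (c * x + d) |f k. smooth f}"
  then obtain f k where h: "h = (\<lambda>x. k * f (c * x + d))" "smooth f" by blast
  have d: "(h has_field_derivative k * c * deriv f (c * x + d)) (at x)" for x
    unfolding h by (auto intro!: derivative_eq_intros DERIV_chain2[OF smooth_DERIV[OF h(2)]])
  thus "h field_differentiable (at x)" for x by (auto simp: field_differentiable_def)
  have "deriv h = (\<lambda>x. k * c * deriv f (c * x + d))"
    using d by (auto intro: DERIV_imp_deriv)
  thus "deriv h \<in> {\<lambda>x. k * f (c * x + d) |f k. smooth f}"
    using h smooth_deriv by blast
qed blast

text \<open>
  The closure under differentiation of the products of smooth functions; finite sums are
  enough because of the product rule.
\<close>

inductive_set sums_of_products :: "(real \<Rightarrow> real) set" where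
  prod: "smooth f \<Longrightarrow> smooth g \<Longrightarrow> (\<lambda>x. f x * g x) \<in> sums_of_products"
| add: "u \<in> sums_of_products \<Longrightarrow> v \<in> sums_of_products \<Longrightarrow> (\<lambda>x. u x + v x) \<in> sums_of_products"

lemma sums_of_products_deriv:
  "h \<in> sums_of_products \<Longrightarrow>
    \<exists>h'\<in>sums_of_products. \<forall>x. (h has_field_derivative h' x) (at x)"
proof (induction rule: sums_of_products.induct)
  case (prod f g)
  have "(\<lambda>x. f x * deriv g x + deriv f x * g x) \<in> sums_of_products"
    using prod by (intro sums_of_products.intros smooth_deriv)
  moreover have "((\<lambda>x. f x * g x) has_field_derivative f x * deriv g x + deriv f x * g x) (at x)" for x
    using DERIV_mult[OF smooth_DERIV[OF prod(1)] smooth_DERIV[OF prod(2)], of x]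
    by (simp add: algebra_simps)
  ultimately show ?case by (intro bexI[of _ "\<lambda>x. f x * deriv g x + deriv f x * g x"]) auto
next
  case (add u v)
  then obtain u' v' where "u' \<in> sums_of_products" "v' \<in> sums_of_products"
    "\<forall>x. (u has_field_derivative u' x) (at x)" "\<forall>x. (v has_field_derivative v' x) (at x)" by blast
  thus ?case
    by (intro bexI[of _ "\<lambda>x. u' x + v' x"]) (auto intro!: DERIV_add sums_of_products.add)
qed

lemma smooth_mult:
  assumes "smooth f" "smooth g"
  shows "smooth (\<lambda>x. f x * g x)"
proof (rule smooth_coinduct[where S = sums_of_products])
  show "(\<lambda>x. f x * g x) \<in> sums_of_products" using assms by (rule sums_of_products.prod)
  fix h assume "h \<in> sums_of_products"
  then obtain h' where h': "h' \<in> sums_of_products" "\<And>x. (h has_field_derivative h' x) (at x)"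
    using sums_of_products_deriv by blast
  thus "h field_differentiable (at x)" for x by (auto simp: field_differentiable_def)
  have "deriv h = h'" using h'(2) by (auto intro: DERIV_imp_deriv)
  thus "deriv h \<in> sums_of_products" using h'(1) by simp
qed

text \<open>
  The family \<open>p(1/x) exp(-1/x)\<close> with polynomial \<open>p\<close>, continued by \<open>0\<close> to the left, is closed under
  differentiation. The case \<open>p = 1\<close> is the standard smooth function that is flat at \<open>0\<close>.
\<close>

definition flat :: "real poly \<Rightarrow> real \<Rightarrow> real" where
  "flat p x = (if x \<le> 0 then 0 else poly p (1 / x) * exp (- (1 / x)))"

lemma poly_exp_tendsto_0: "((\<lambda>t. poly p t * exp (- t)) \<longlongrightarrow> 0) (at_top :: real filter)"
proof -
  have "((\<lambda>t. \<Sum>i\<le>degree p. coeff p i * (t ^ i / exp t)) \<longlongrightarrow> (\<Sum>i\<le>degree p. coeff p i * 0)) at_top"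
    by (intro tendsto_intros tendsto_power_div_exp_0)
  moreover have "(\<lambda>t. \<Sum>i\<le>degree p. coeff p i * (t ^ i / exp t)) = (\<lambda>t. poly p t * exp (- t))"
    by (simp add: poly_altdef sum_distrib_left exp_minus divide_inverse algebra_simps)
  ultimately show ?thesis by simp
qed

lemma flat_tendsto_0: "(flat p \<longlongrightarrow> 0) (at 0)"
proof (rule filterlim_split_at_real)
  show "(flat p \<longlongrightarrow> 0) (at_left 0)"
    by (rule tendsto_eventually) (auto simp: flat_def eventually_at_left_field intro!: exI[of _ "-1"])
  have "((\<lambda>x::real. poly p (inverse x) * exp (- inverse x)) \<longlongrightarrow> 0) (at_right 0)"
    by (rule filterlim_compose[OF poly_exp_tendsto_0 filterlim_inverse_at_top_right])
  thus "(flat p \<longlongrightarrow> 0) (at_right 0)"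
    by (rule Lim_transform_eventually)
       (auto simp: flat_def eventually_at_right_field inverse_eq_divide intro!: exI[of _ 1])
qed

text \<open>
  The factor \<open>monom 1 2\<close> is the \<open>1/x\<^sup>2\<close> from the inner derivative of \<open>1/x\<close>. At \<open>0\<close> the difference quotient
  of \<open>flat p\<close> is \<open>flat (monom 1 1 * p)\<close>, again a member of the family, so it tends to \<open>0\<close>.
\<close>

lemma flat_DERIV:
  "(flat p has_field_derivative flat (monom 1 2 * (p - pderiv p)) x) (at x)"
proof -
  consider "x < 0" | "x = 0" | "x > 0" by linarith
  thus ?thesis
  proof cases
    case 1
    have "((\<lambda>x. 0) has_field_derivative 0) (at x)" by simp
    hence "(flat p has_field_derivative 0) (at x)"
      by (rule has_field_derivative_transform_within_open[of _ _ _ "{..<0}"])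
         (use 1 in \<open>auto simp: flat_def\<close>)
    thus ?thesis using 1 by (simp add: flat_def)
  next
    case 2
    have "(\<lambda>h. (flat p (0 + h) - flat p 0) / h) = flat (monom 1 1 * p)"
      by (auto simp: flat_def fun_eq_iff poly_monom)
    hence "(flat p has_field_derivative 0) (at 0)"
      using flat_tendsto_0[of "monom 1 1 * p"] by (simp add: DERIV_def)
    thus ?thesis using 2 by (simp add: flat_def)
  next
    case 3
    have "((\<lambda>x. poly p (1 / x) * exp (- (1 / x))) has_field_derivative
         flat (monom 1 2 * (p - pderiv p)) x) (at x)"
      using 3 by (auto intro!: derivative_eq_intros DERIV_chain2[OF poly_DERIV]
          simp: flat_def poly_monom field_simps power2_eq_square)
    thus ?thesis
      by (rule has_field_derivative_transform_within_open[of _ _ _ "{0<..}"])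
         (use 3 in \<open>auto simp: flat_def\<close>)
  qed
qed

lemma smooth_flat: "smooth (flat p)"
proof (rule smooth_coinduct[where S = "range flat"])
  fix g assume "g \<in> range flat"
  then obtain q where g: "g = flat q" by blast
  show "g field_differentiable (at x)" for x
    using flat_DERIV unfolding g field_differentiable_def by blast
  have "deriv g = flat (monom 1 2 * (q - pderiv q))"
    unfolding g using flat_DERIV by (auto intro: DERIV_imp_deriv)
  thus "deriv g \<in> range flat" by blast
qed blast

text \<open>
  As \<open>n\<close> grows, the two flanks become steep and the functions increase to the indicator of the open
  interval from \<open>a\<close> to \<open>b\<close>, while the support stays in \<open>{a..b}\<close>.
\<close>

definition bump :: "real \<Rightarrow> real \<Rightarrow> nat \<Rightarrow> real \<Rightarrow> real" where
  "bump a b n x = flat 1 (real (Suc n) * (x - a)) * flat 1 (real (Suc n) * (b - x))"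

lemma flat_1_bounds: "0 \<le> flat 1 x" "flat 1 x \<le> 1"
  by (auto simp: flat_def)

lemma bump_bounds: "0 \<le> bump a b n x" "bump a b n x \<le> 1"
  unfolding bump_def by (intro mult_nonneg_nonneg mult_le_one flat_1_bounds)+

lemma bump_eq_0: "x \<le> a \<or> b \<le> x \<Longrightarrow> bump a b n x = 0"
  by (auto simp: bump_def flat_def mult_le_0_iff)

lemma bump_pos: "a < x \<Longrightarrow> x < b \<Longrightarrow> bump a b n x > 0"
  by (auto simp: bump_def flat_def mult_le_0_iff)

lemma smooth_bump: "smooth (bump a b n)"
proof -
  have "smooth (\<lambda>x. 1 * flat 1 (c * x + d))" for c d by (rule smooth_affine[OF smooth_flat])
  hence "smooth (\<lambda>x. (flat 1 (real (Suc n) * x + - real (Suc n) * a))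
     * (flat 1 (- real (Suc n) * x + real (Suc n) * b)))"
    by (intro smooth_mult) simp_all
  thus ?thesis unfolding bump_def by (simp add: algebra_simps)
qed

lemma bump_tendsto:
  assumes "a < x" "x < b"
  shows "(\<lambda>n. bump a b n x) \<longlonglongrightarrow> 1"
proof -
  have f: "(\<lambda>n. flat 1 (real (Suc n) * t)) \<longlonglongrightarrow> 1" if "t > 0" for t
  proof -
    have "(\<lambda>n. exp (- (inverse (real (Suc n)) * (1 / t)))) \<longlonglongrightarrow> exp (- (0 * (1 / t)))"
      by (intro tendsto_intros LIMSEQ_inverse_real_of_nat)
    moreover have "exp (- (inverse (real (Suc n)) * (1 / t))) = flat 1 (real (Suc n) * t)" for n
      using that by (simp add: flat_def mult_le_0_iff inverse_eq_divide)
    ultimately show ?thesis by simp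
  qed
  have "(\<lambda>n. bump a b n x) \<longlonglongrightarrow> 1 * 1"
    unfolding bump_def using assms by (intro tendsto_mult f) auto
  thus ?thesis by simp
qed

text \<open>
  A support inside a compact subinterval is easier to verify, and to combine for two functions, than
  a condition on a closure.
\<close>

lemma Cc_smooth_iff_interval_support:
  "Cc_smooth (Omega L) = {\<phi>. smooth \<phi> \<and> (\<exists>c d. -L < c \<and> c \<le> d \<and> d < L \<and> (\<forall>x. x \<notin> {c..d} \<longrightarrow> \<phi> x = 0))}"
  if "L > 0"
proof (intro set_eqI iffI)
  fix \<phi> assume "\<phi> \<in> Cc_smooth (Omega L)"
  hence s: "smooth \<phi>" and k: "compact (closure {x. \<phi> x \<noteq> 0})" "closure {x. \<phi> x \<noteq> 0} \<subseteq> {-L<..<L}"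
    by (auto simp: Cc_smooth_def Cc_def smooth_def)
  \<comment> \<open>The point 0 is added so that the minimum and the maximum exist when the support is empty.\<close>
  let ?K = "insert 0 (closure {x. \<phi> x \<noteq> 0})"
  have K: "compact ?K" "?K \<noteq> {}" "?K \<subseteq> {-L<..<L}" using k that by auto
  obtain c where c: "c \<in> ?K" "\<forall>x\<in>?K. c \<le> x" using compact_attains_inf[OF K(1,2)] by blast
  obtain d where d: "d \<in> ?K" "\<forall>x\<in>?K. x \<le> d" using compact_attains_sup[OF K(1,2)] by blast
  have "\<phi> x = 0" if "x \<notin> {c..d}" for x
    using that c d closure_subset[of "{x. \<phi> x \<noteq> 0}"] by (metis (mono_tags) atLeastAtMost_iff insertCI
        mem_Collect_eq subsetD)
  moreover have "-L < c" "c \<le> d" "d < L" using c d K(3) by auto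
  ultimately show "\<phi> \<in> {\<phi>. smooth \<phi> \<and> (\<exists>c d. -L < c \<and> c \<le> d \<and> d < L \<and> (\<forall>x. x \<notin> {c..d} \<longrightarrow> \<phi> x = 0))}"
    using s by blast
next
  fix \<phi> assume "\<phi> \<in> {\<phi>. smooth \<phi> \<and> (\<exists>c d. -L < c \<and> c \<le> d \<and> d < L \<and> (\<forall>x. x \<notin> {c..d} \<longrightarrow> \<phi> x = 0))}"
  then obtain c d where s: "smooth \<phi>" and cd: "-L < c" "d < L" and z: "\<And>x. x \<notin> {c..d} \<Longrightarrow> \<phi> x = 0" by blast
  have sub: "closure {x. \<phi> x \<noteq> 0} \<subseteq> {c..d}"
  proof (rule closure_minimal)
    show "{x. \<phi> x \<noteq> 0} \<subseteq> {c..d}" using z by blast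
  qed simp
  have "bounded (closure {x. \<phi> x \<noteq> 0})" by (rule bounded_subset[OF _ sub]) simp
  hence "compact (closure {x. \<phi> x \<noteq> 0})" by (simp add: compact_eq_bounded_closed)
  moreover have "closure {x. \<phi> x \<noteq> 0} \<subseteq> {-L<..<L}" using sub cd by force
  ultimately show "\<phi> \<in> Cc_smooth (Omega L)"
    using s smooth_continuous[OF s] by (simp add: Cc_smooth_def Cc_def smooth_def)
qed

section \<open>Distributional derivatives and primitives\<close>

text \<open>
  Testing with the bump functions of an interval shows that \<open>h\<close> has integral \<open>0\<close> over it. By the
  Lebesgue differentiation theorem, almost every value of \<open>h\<close> is a limit of such integrals.
\<close>

lemma fundamental_lemma_calculus_of_variations:
  fixes h :: "real \<Rightarrow> real"
  assumes L: "L > 0" and h: "h absolutely_integrable_on {-L..L}"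
    and z: "\<And>\<phi>. \<phi> \<in> Cc_smooth (Omega L) \<Longrightarrow> integral {-L..L} (\<lambda>x. h x * \<phi> x) = 0"
  shows "\<exists>N. negligible N \<and> (\<forall>x\<in>Omega L - N. h x = 0)"
proof -
  have int0: "integral {a..b} h = 0" if ab: "-L < a" "a \<le> b" "b < L" for a b
  proof -
    have conv: "(\<lambda>n. integral {-L..L} (\<lambda>x. h x * bump a b n x))
       \<longlonglongrightarrow> integral {-L..L} (\<lambda>x. if x \<in> {a<..<b} then h x else 0)"
    proof (rule dominated_convergence(2)[where h = "\<lambda>x. \<bar>h x\<bar>"])
      show "(\<lambda>x. h x * bump a b n x) integrable_on {-L..L}" for n
      proof -
        have "bounded (bump a b n ` {-L..L})"
          using bump_bounds[of a b n] by (intro boundedI[of _ 1]) auto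
        moreover have "bump a b n \<in> borel_measurable (lebesgue_on {-L..L})"
          by (intro continuous_imp_measurable_on_sets_lebesgue smooth_continuous smooth_bump) auto
        ultimately have "(\<lambda>x. bump a b n x * h x) absolutely_integrable_on {-L..L}"
          using h by (intro absolutely_integrable_bounded_measurable_product_real) auto
        thus ?thesis by (simp add: absolutely_integrable_on_def mult.commute)
      qed
      show "(\<lambda>x. \<bar>h x\<bar>) integrable_on {-L..L}"
        using set_integrable_abs[OF h] by (simp add: absolutely_integrable_on_def)
      show "norm (h x * bump a b n x) \<le> \<bar>h x\<bar>" for n x
        using bump_bounds[of a b n x] by (simp add: abs_mult mult_left_le)
      show "(\<lambda>n. h x * bump a b n x) \<longlonglongrightarrow> (if x \<in> {a<..<b} then h x else 0)" for x
      proof (cases "x \<in> {a<..<b}")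
        case True
        thus ?thesis using tendsto_mult[OF tendsto_const bump_tendsto, of a x b "h x"] by simp
      next
        case False
        thus ?thesis using bump_eq_0[of x a b] by force
      qed
    qed
    have "bump a b n \<in> Cc_smooth (Omega L)" for n
    proof -
      have "bump a b n x = 0" if "x \<notin> {a..b}" for x
        using that by (intro bump_eq_0) auto
      thus ?thesis unfolding Cc_smooth_iff_interval_support[OF L] using smooth_bump ab by blast
    qed
    hence "integral {-L..L} (\<lambda>x. h x * bump a b n x) = 0" for n by (rule z)
    hence "integral {-L..L} (\<lambda>x. if x \<in> {a<..<b} then h x else 0) = 0"
      using conv by (simp add: LIMSEQ_const_iff)
    moreover have "integral {-L..L} (\<lambda>x. if x \<in> {a<..<b} then h x else 0) = integral {a<..<b} h"
      using ab by (subst integral_restrict_Int) (auto intro!: arg_cong[where f = "\<lambda>S. integral S h"])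
    ultimately show ?thesis by (simp add: integral_open_interval_real)
  qed
  define g where "g = (\<lambda>x. if x \<in> {-L..L} then h x else 0)"
  have "g integrable_on UNIV"
    unfolding g_def integrable_restrict_UNIV using h by (simp add: absolutely_integrable_on_def)
  hence "g integrable_on cbox a b" for a b by (rule integrable_on_subcbox) auto
  then obtain N where N: "negligible N"
     "\<And>x e. \<lbrakk>x \<notin> N; 0 < e\<rbrakk> \<Longrightarrow> \<exists>d>0. \<forall>r. 0 < r \<and> r < d \<longrightarrow>
           norm (integral (cbox x (x + r *\<^sub>R One)) g /\<^sub>R r ^ DIM(real) - g x) < e"
    using integrable_ccontinuous_explicit[of g] by metis
  have "h x = 0" if x: "x \<in> Omega L - N" for x
  proof -
    have "\<bar>g x\<bar> \<le> 0 + e" if e: "e > 0" for e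
    proof -
      obtain d where d: "d > 0" "\<And>r. 0 < r \<Longrightarrow> r < d \<Longrightarrow> norm (integral {x..x + r} g /\<^sub>R r - g x) < e"
        using N(2)[of x e] x e by auto
      define r where "r = min (d / 2) ((L - x) / 2)"
      have r: "0 < r" "r < d" "x + r < L" using x d(1) by (auto simp: r_def min_def field_simps)
      have "integral {x..x + r} g = integral {x..x + r} h"
        using x r by (intro integral_cong) (auto simp: g_def)
      also have "\<dots> = 0" using x r by (intro int0) auto
      finally show ?thesis using d(2)[OF r(1,2)] by simp
    qed
    hence "\<bar>g x\<bar> \<le> 0" by (rule field_le_epsilon)
    thus ?thesis using x by (simp add: g_def)
  qed
  thus ?thesis using N(1) by blast
qed

lemma Cc_smooth_primitive:
  assumes L: "L > 0" and \<phi>: "\<phi> \<in> Cc_smooth (Omega L)"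
  shows "primitive_on (-L) L \<phi> (deriv \<phi>)" "\<phi> (-L) = 0" "\<phi> L = 0" "smooth \<phi>"
proof -
  from \<phi> obtain c d where s: "smooth \<phi>" and cd: "-L < c" "d < L"
    and z: "\<And>x. x \<notin> {c..d} \<Longrightarrow> \<phi> x = 0" unfolding Cc_smooth_iff_interval_support[OF L] by blast
  show "\<phi> (-L) = 0" "\<phi> L = 0" using cd z by auto
  show "smooth \<phi>" by fact
  show "primitive_on (-L) L \<phi> (deriv \<phi>)"
  proof (rule primitive_onI)
    show "deriv \<phi> absolutely_integrable_on {-L..L}"
      by (intro absolutely_integrable_continuous_real smooth_continuous smooth_deriv s)
    fix y assume y: "y \<in> {-L..L}"
    have "(deriv \<phi> has_integral \<phi> y - \<phi> (-L)) {-L..y}"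
      using y by (intro fundamental_theorem_of_calculus)
        (auto intro!: has_vector_derivative_at_within[OF smooth_DERIV[OF s,
            unfolded has_real_derivative_iff_has_vector_derivative]])
    thus "\<phi> y = \<phi> (-L) + integral {-L..y} (deriv \<phi>)" by (simp add: integral_unique)
  qed
qed

text \<open>
  The mean value zero makes the antiderivative vanish again to the right of the support.
\<close>

lemma Cc_smooth_antiderivative:
  assumes L: "L > 0" and \<zeta>: "\<zeta> \<in> Cc_smooth (Omega L)" and i0: "integral {-L..L} \<zeta> = 0"
  shows "\<exists>\<phi>\<in>Cc_smooth (Omega L). deriv \<phi> = \<zeta>"
proof -
  from \<zeta> obtain c d where s: "smooth \<zeta>" and cd: "-L < c" "c \<le> d" "d < L"
    and z: "\<And>x. x \<notin> {c..d} \<Longrightarrow> \<zeta> x = 0" unfolding Cc_smooth_iff_interval_support[OF L] by blast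
  define Z where "Z = (\<lambda>x. integral {-L..x} \<zeta>)"
  have Zc: "Z x = 0" if "x < c" for x
  proof -
    have "integral {-L..x} \<zeta> = integral {-L..x} (\<lambda>_. 0)"
      using z that by (intro integral_cong) auto
    thus ?thesis by (simp add: Z_def)
  qed
  have D: "(Z has_field_derivative \<zeta> x) (at x)" for x
  proof (cases "x < c")
    case True
    have "((\<lambda>x. 0) has_field_derivative 0) (at x)" by simp
    hence "(Z has_field_derivative 0) (at x)"
      by (rule has_field_derivative_transform_within_open[of _ _ _ "{..<c}"])
         (use True Zc in auto)
    thus ?thesis using z True by simp
  next
    case False
    have "(Z has_field_derivative \<zeta> x) (at x within {-L..x + 1})"
      unfolding Z_def using False cd
      by (intro integral_has_real_derivative smooth_continuous s) auto
    moreover have "at x within {-L..x + 1} = at x"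
      using False cd by (intro at_within_interior) simp
    ultimately show ?thesis by simp
  qed
  have Zd: "Z x = 0" if "x > d" for x
  proof -
    have zero: "integral {p..q} \<zeta> = 0" if "p > d" for p q
    proof -
      have "integral {p..q} \<zeta> = integral {p..q} (\<lambda>_. 0)"
        using z that by (intro integral_cong) auto
      thus ?thesis by simp
    qed
    have "\<zeta> integrable_on {p..q}" for p q
      by (intro integrable_continuous_real smooth_continuous s)
    hence comb: "integral {-L..min x L} \<zeta> + integral {min x L..y} \<zeta> = integral {-L..y} \<zeta>"
      if "y \<ge> min x L" for y
      using that \<open>x > d\<close> cd by (intro Henstock_Kurzweil_Integration.integral_combine) auto
    have "min x L > d" using that cd by auto
    thus ?thesis
      using comb[of x] comb[of L] zero[of "min x L"] i0 by (simp add: Z_def)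
  qed
  have "smooth Z" by (rule smooth_antideriv[OF D s])
  moreover have "Z x = 0" if "x \<notin> {c..d}" for x using that Zc Zd by force
  ultimately have "Z \<in> Cc_smooth (Omega L)" unfolding Cc_smooth_iff_interval_support[OF L] using cd by blast
  moreover have "deriv Z = \<zeta>" using D by (auto intro: DERIV_imp_deriv)
  ultimately show ?thesis by blast
qed

lemma absolutely_integrable_smooth_mult:
  assumes "h absolutely_integrable_on {a..b}" "smooth \<phi>"
  shows "(\<lambda>x. h x * \<phi> x) absolutely_integrable_on {a..b}"
proof -
  have "primitive_on a b (\<lambda>y. integral {a..y} h) h"
    using assms(1) by (intro primitive_onI[where c = 0]) auto
  from primitive_continuous_mult[OF this smooth_continuous[OF assms(2)]] show ?thesis
    by (simp add: mult.commute)
qed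

text \<open>
  For a fixed bump \<open>\<psi>\<close>, every test function minus a suitable multiple of \<open>\<psi>\<close> has mean zero, hence is
  the derivative of a test function. So \<open>h - c\<close> is orthogonal to all test functions when \<open>c\<close> is the
  \<open>\<psi>\<close>-weighted mean of \<open>h\<close>, and the fundamental lemma applies.
\<close>

lemma du_Bois_Reymond:
  fixes h :: "real \<Rightarrow> real"
  assumes L: "L > 0" and h: "h absolutely_integrable_on {-L..L}"
    and z: "\<And>\<phi>. \<phi> \<in> Cc_smooth (Omega L) \<Longrightarrow> integral {-L..L} (\<lambda>x. h x * deriv \<phi> x) = 0"
  shows "\<exists>c N. negligible N \<and> (\<forall>x\<in>Omega L - N. h x = c)"
proof -
  define \<psi> where "\<psi> = bump (-(L/2)) (L/2) 0"
  have s\<psi>: "smooth \<psi>" unfolding \<psi>_def by (rule smooth_bump)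
  have z\<psi>: "\<forall>x. x \<notin> {-(L/2)..L/2} \<longrightarrow> \<psi> x = 0"
    unfolding \<psi>_def by (auto intro!: bump_eq_0)
  have \<psi>: "\<psi> \<in> Cc_smooth (Omega L)"
    unfolding Cc_smooth_iff_interval_support[OF L]
  proof (intro CollectI conjI exI)
    show "- L < - (L / 2)" "- (L / 2) \<le> L / 2" "L / 2 < L" using L by auto
  qed (fact s\<psi> z\<psi>)+
  define m where "m = integral {-L..L} \<psi>"
  have im: "f integrable_on {-L..L}" if "smooth f" for f
    by (intro integrable_continuous_real smooth_continuous that)
  have "m \<noteq> 0"
  proof
    assume "m = 0"
    hence "(\<psi> has_integral 0) {-L..L}"
      using im[OF s\<psi>] by (simp add: m_def has_integral_iff)
    hence "\<psi> 0 = 0"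
      using has_integral_0_cbox_imp_0[of "-L" L \<psi> 0] smooth_continuous[OF s\<psi>] L
        bump_bounds(1)[of "-(L/2)" "L/2" 0] by (auto simp: \<psi>_def)
    thus False using bump_pos[of "-(L/2)" 0 "L/2" 0] L by (simp add: \<psi>_def)
  qed
  define c where "c = integral {-L..L} (\<lambda>x. h x * \<psi> x) / m"
  have hm: "(\<lambda>x. h x * f x) integrable_on {-L..L}" if "smooth f" for f
    using absolutely_integrable_smooth_mult[OF h that] by (simp add: absolutely_integrable_on_def)
  have "\<exists>N. negligible N \<and> (\<forall>x\<in>Omega L - N. h x - c = 0)"
  proof (rule fundamental_lemma_calculus_of_variations[OF L])
    show "(\<lambda>x. h x - c) absolutely_integrable_on {-L..L}"
      using h by (intro set_integral_diff absolutely_integrable_on_const) auto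
    fix \<eta> assume \<eta>: "\<eta> \<in> Cc_smooth (Omega L)"
    have s\<eta>: "smooth \<eta>" by (rule Cc_smooth_primitive[OF L \<eta>])
    define k where "k = integral {-L..L} \<eta> / m"
    define \<zeta> where "\<zeta> = (\<lambda>x. \<eta> x + (- k) * \<psi> x)"
    have s\<zeta>: "smooth \<zeta>"
      using smooth_add[OF s\<eta> smooth_affine[OF s\<psi>, of "-k" 1 0]] by (simp add: \<zeta>_def)
    have "\<zeta> \<in> Cc_smooth (Omega L)"
    proof -
      from \<eta> obtain c1 d1 where 1: "-L < c1" "c1 \<le> d1" "d1 < L" "\<And>x. x \<notin> {c1..d1} \<Longrightarrow> \<eta> x = 0"
        unfolding Cc_smooth_iff_interval_support[OF L] by blast
      from \<psi> obtain c2 d2 where 2: "-L < c2" "c2 \<le> d2" "d2 < L" "\<And>x. x \<notin> {c2..d2} \<Longrightarrow> \<psi> x = 0"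
        unfolding Cc_smooth_iff_interval_support[OF L] by blast
      have z: "\<forall>x. x \<notin> {min c1 c2..max d1 d2} \<longrightarrow> \<zeta> x = 0"
      proof (intro allI impI)
        fix x assume "x \<notin> {min c1 c2..max d1 d2}"
        hence "x \<notin> {c1..d1}" "x \<notin> {c2..d2}" by auto
        thus "\<zeta> x = 0" using 1(4) 2(4) by (simp add: \<zeta>_def)
      qed
      show ?thesis unfolding Cc_smooth_iff_interval_support[OF L]
      proof (intro CollectI conjI exI)
        show "- L < min c1 c2" "min c1 c2 \<le> max d1 d2" "max d1 d2 < L" using 1 2 by auto
      qed (fact s\<zeta> z)+
    qed
    moreover have "integral {-L..L} \<zeta> = 0"
      unfolding \<zeta>_def using im[OF s\<eta>] im[OF s\<psi>] \<open>m \<noteq> 0\<close>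
      by (subst Henstock_Kurzweil_Integration.integral_add)
        (auto intro!: integrable_on_mult_right integrable_neg simp: k_def m_def)
    ultimately obtain \<phi> where "\<phi> \<in> Cc_smooth (Omega L)" "deriv \<phi> = \<zeta>"
      using Cc_smooth_antiderivative[OF L] by blast
    hence "0 = integral {-L..L} (\<lambda>x. h x * \<zeta> x)" using z[of \<phi>] by simp
    also have "\<dots> = integral {-L..L} (\<lambda>x. h x * \<eta> x + (- k) * (h x * \<psi> x))"
      by (simp add: \<zeta>_def algebra_simps)
    also have "\<dots> = integral {-L..L} (\<lambda>x. h x * \<eta> x) - k * integral {-L..L} (\<lambda>x. h x * \<psi> x)"
      using hm[OF s\<eta>] hm[OF s\<psi>]
      by (subst Henstock_Kurzweil_Integration.integral_add)
        (auto intro!: integrable_on_mult_right integrable_neg)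
    also have "k * integral {-L..L} (\<lambda>x. h x * \<psi> x) = c * integral {-L..L} \<eta>"
      by (simp add: k_def c_def)
    also have "integral {-L..L} (\<lambda>x. h x * \<eta> x) - c * integral {-L..L} \<eta>
       = integral {-L..L} (\<lambda>x. h x * \<eta> x - c * \<eta> x)"
      using hm[OF s\<eta>] im[OF s\<eta>]
      by (subst Henstock_Kurzweil_Integration.integral_diff)
        (auto intro!: integrable_on_mult_right)
    finally show "integral {-L..L} (\<lambda>x. (h x - c) * \<eta> x) = 0" by (simp add: algebra_simps)
  qed
  thus ?thesis by auto
qed

section \<open>Square-integrable functions\<close>

lemma integrable_Omega_iff:
  fixes f :: "real \<Rightarrow> real"
  shows
  "integrable (lebesgue_on (Omega L)) f \<longleftrightarrow> f absolutely_integrable_on {-L..L}"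
proof -
  have "integrable (lebesgue_on (Omega L)) f \<longleftrightarrow> f absolutely_integrable_on (Omega L)"
    by (simp add: integrable_restrict_space set_integrable_def)
  also have "\<dots> \<longleftrightarrow> f absolutely_integrable_on {-L..L}"
  proof (rule absolutely_integrable_spike_set_eq)
    show "negligible {x \<in> Omega L - {-L..L}. f x \<noteq> 0}"
      by (rule negligible_subset[of "{}"]) auto
    show "negligible {x \<in> {-L..L} - Omega L. f x \<noteq> 0}"
      by (rule negligible_subset[of "{-L,L}"]) auto
  qed
  finally show ?thesis .
qed

lemma LINT_Omega:
  fixes f :: "real \<Rightarrow> real"
  assumes "f absolutely_integrable_on {-L..L}"
  shows "(LINT x|lebesgue_on (Omega L). f x) = integral {-L..L} f"
  using lebesgue_integral_eq_integral[of "Omega L" f] assms integral_open_interval_real[of "-L" L f]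
  by (simp add: integrable_Omega_iff)

lemma AE_Omega_iff:
  "(AE x in lebesgue_on (Omega L). P x) \<longleftrightarrow> (\<exists>N. negligible N \<and> (\<forall>x\<in>Omega L - N. P x))"
proof -
  have "(AE x in lebesgue_on (Omega L). P x) \<longleftrightarrow> (AE x in lebesgue. x \<in> Omega L \<longrightarrow> P x)"
    by (subst AE_restrict_space_iff) auto
  also have "\<dots> \<longleftrightarrow> (\<exists>N. negligible N \<and> (\<forall>x\<in>Omega L - N. P x))"
  proof -
    have "{x \<in> space lebesgue. \<not> (x \<in> Omega L \<longrightarrow> P x)} \<subseteq> N \<longleftrightarrow> (\<forall>x\<in>Omega L - N. P x)" for N
      by auto
    thus ?thesis unfolding negligible_iff_null_sets eventually_ae_filter by (simp add: Bex_def)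
  qed
  finally show ?thesis .
qed

lemma L2_measurable: "u \<in> L2 L \<Longrightarrow> u \<in> borel_measurable (lebesgue_on (Omega L))"
  by (simp add: L2_def)

lemma L2_mult:
  assumes "u \<in> L2 L" "v \<in> L2 L"
  shows "integrable (lebesgue_on (Omega L)) (\<lambda>x. u x * v x)"
proof (rule Bochner_Integration.integrable_bound)
  show "integrable (lebesgue_on (Omega L)) (\<lambda>x. (u x)\<^sup>2 + (v x)\<^sup>2)"
    using assms by (auto simp: L2_def)
  show "(\<lambda>x. u x * v x) \<in> borel_measurable (lebesgue_on (Omega L))"
    using assms by (auto simp: L2_def)
  show "AE x in lebesgue_on (Omega L). norm (u x * v x) \<le> norm ((u x)\<^sup>2 + (v x)\<^sup>2)"
  proof (rule AE_I2)
    fix x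
    have "2 * \<bar>u x\<bar> * \<bar>v x\<bar> \<le> (u x)\<^sup>2 + (v x)\<^sup>2"
      using sum_squares_bound[of "\<bar>u x\<bar>" "\<bar>v x\<bar>"] by simp
    moreover have "0 \<le> \<bar>u x\<bar> * \<bar>v x\<bar>" by simp
    ultimately have "\<bar>u x\<bar> * \<bar>v x\<bar> \<le> (u x)\<^sup>2 + (v x)\<^sup>2" by linarith
    thus "norm (u x * v x) \<le> norm ((u x)\<^sup>2 + (v x)\<^sup>2)" by (simp add: abs_mult)
  qed
qed

lemma L2_bounded_mult:
  assumes "f \<in> borel_measurable (lebesgue_on (Omega L))" "\<And>x. x \<in> Omega L \<Longrightarrow> \<bar>f x\<bar> \<le> C" "v \<in> L2 L"
  shows "(\<lambda>x. f x * v x) \<in> L2 L"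
proof -
  have "integrable (lebesgue_on (Omega L)) (\<lambda>x. (f x * v x)\<^sup>2)"
  proof (rule Bochner_Integration.integrable_bound)
    show "integrable (lebesgue_on (Omega L)) (\<lambda>x. C\<^sup>2 * (v x)\<^sup>2)"
      using assms by (auto simp: L2_def)
    show "(\<lambda>x. (f x * v x)\<^sup>2) \<in> borel_measurable (lebesgue_on (Omega L))"
      using assms by (auto simp: L2_def)
    show "AE x in lebesgue_on (Omega L). norm ((f x * v x)\<^sup>2) \<le> norm (C\<^sup>2 * (v x)\<^sup>2)"
    proof (rule AE_I2)
      fix x assume "x \<in> space (lebesgue_on (Omega L))"
      hence "\<bar>f x\<bar>\<^sup>2 \<le> C\<^sup>2" using assms(2)[of x] by (intro power_mono) auto
      thus "norm ((f x * v x)\<^sup>2) \<le> norm (C\<^sup>2 * (v x)\<^sup>2)"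
        by (simp add: power_mult_distrib mult_right_mono)
    qed
  qed
  thus ?thesis using assms by (auto simp: L2_def)
qed

lemma L2_const: "(\<lambda>x. c) \<in> L2 L"
  using integrable_Omega_iff[of L "\<lambda>x. c\<^sup>2"] by (simp add: L2_def absolutely_integrable_on_const)

lemma L2_cmult: "v \<in> L2 L \<Longrightarrow> (\<lambda>x. c * v x) \<in> L2 L"
  by (rule L2_bounded_mult[where C = "\<bar>c\<bar>"]) auto

lemma L2_uminus: "v \<in> L2 L \<Longrightarrow> (\<lambda>x. - v x) \<in> L2 L"
  using L2_cmult[of v L "-1"] by simp

lemma L2_add:
  assumes "u \<in> L2 L" "v \<in> L2 L"
  shows "(\<lambda>x. u x + v x) \<in> L2 L"
proof -
  have "(\<lambda>x. (u x + v x)\<^sup>2) = (\<lambda>x. (u x)\<^sup>2 + (v x)\<^sup>2 + 2 * (u x * v x))"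
    by (simp add: power2_sum mult.assoc)
  moreover have "integrable (lebesgue_on (Omega L)) (\<lambda>x. (u x)\<^sup>2 + (v x)\<^sup>2 + 2 * (u x * v x))"
    using assms L2_mult[OF assms] by (auto simp: L2_def)
  ultimately show ?thesis using assms by (auto simp: L2_def)
qed

lemma L2_diff: "u \<in> L2 L \<Longrightarrow> v \<in> L2 L \<Longrightarrow> (\<lambda>x. u x - v x) \<in> L2 L"
  using L2_add[OF _ L2_uminus] by simp

lemma L2_abs: "v \<in> L2 L \<Longrightarrow> (\<lambda>x. \<bar>v x\<bar>) \<in> L2 L"
  by (auto simp: L2_def)

lemma L2_integrable: "v \<in> L2 L \<Longrightarrow> integrable (lebesgue_on (Omega L)) v"
  using L2_mult[OF L2_const, of v L 1] by simp

lemma L2_absolutely_integrable: "v \<in> L2 L \<Longrightarrow> v absolutely_integrable_on {-L..L}"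
  using L2_integrable integrable_Omega_iff by blast

lemma continuous_measurable_Omega:
  assumes "continuous_on {-L..L} f"
  shows "f \<in> borel_measurable (lebesgue_on (Omega L))"
  by (intro continuous_imp_measurable_on_sets_lebesgue continuous_on_subset[OF assms]) auto

lemma continuous_bounded_Omega:
  assumes "continuous_on {-L..L} f"
  shows "\<exists>C. \<forall>x\<in>Omega L. \<bar>f x :: real\<bar> \<le> C"
proof -
  have "bounded (f ` {-L..L})"
    using assms compact_continuous_image compact_imp_bounded by blast
  then obtain C where "\<forall>y\<in>f ` {-L..L}. norm y \<le> C" by (auto simp: bounded_iff)
  thus ?thesis by (intro exI[of _ C]) auto
qed

lemma L2_continuous_mult: "continuous_on {-L..L} f \<Longrightarrow> v \<in> L2 L \<Longrightarrow> (\<lambda>x. f x * v x) \<in> L2 L"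
  using continuous_bounded_Omega[of L f] L2_bounded_mult[OF continuous_measurable_Omega] by blast

lemma L2_continuous: "continuous_on {-L..L} f \<Longrightarrow> f \<in> L2 L"
  using L2_continuous_mult[OF _ L2_const, of L f 1] by simp

lemma L2_AE_cong:
  assumes "v \<in> L2 L" "u \<in> borel_measurable (lebesgue_on (Omega L))" "AE x in lebesgue_on (Omega L). u x = v x"
  shows "u \<in> L2 L"
proof -
  have "integrable (lebesgue_on (Omega L)) (\<lambda>x. (u x)\<^sup>2) \<longleftrightarrow> integrable (lebesgue_on (Omega L)) (\<lambda>x. (v x)\<^sup>2)"
    using assms by (intro integrable_cong_AE) (auto simp: L2_def)
  thus ?thesis using assms by (auto simp: L2_def)
qed

section \<open>The space H1 in terms of primitives\<close>

lemma has_distr_deriv_primitive: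
  assumes L: "L > 0" and p: "primitive_on (-L) L u' v" and u: "u \<in> borel_measurable (lebesgue_on (Omega L))"
    and ae: "AE x in lebesgue_on (Omega L). u x = u' x"
  shows "has_distr_deriv L u v"
  unfolding has_distr_deriv_def
proof
  fix \<phi> assume \<phi>: "\<phi> \<in> Cc_smooth (Omega L)"
  note q = Cc_smooth_primitive[OF L \<phi>]
  have le: "-L \<le> L" using L by simp
  note bp = primitive_by_parts[OF p q(1) le]
  have "(LINT x|lebesgue_on (Omega L). u x * deriv \<phi> x) = (LINT x|lebesgue_on (Omega L). u' x * deriv \<phi> x)"
  proof (rule integral_cong_AE)
    have "deriv \<phi> \<in> borel_measurable (lebesgue_on (Omega L))"
      by (intro continuous_measurable_Omega smooth_continuous smooth_deriv q)
    thus "(\<lambda>x. u x * deriv \<phi> x) \<in> borel_measurable (lebesgue_on (Omega L))"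
      "(\<lambda>x. u' x * deriv \<phi> x) \<in> borel_measurable (lebesgue_on (Omega L))"
      using u continuous_measurable_Omega[OF primitive_continuous_on[OF p]] by auto
    show "AE x in lebesgue_on (Omega L). u x * deriv \<phi> x = u' x * deriv \<phi> x"
      using ae by eventually_elim simp
  qed
  also have "\<dots> = - integral {-L..L} (\<lambda>x. v x * \<phi> x)"
    unfolding LINT_Omega[OF bp(1)] bp(3) q(2,3) by simp
  also have "\<dots> = - (LINT x|lebesgue_on (Omega L). v x * \<phi> x)"
    unfolding LINT_Omega[OF bp(2)] ..
  finally show "(LINT x|lebesgue_on (Omega L). u x * deriv \<phi> x) =
        - (LINT x|lebesgue_on (Omega L). v x * \<phi> x)" .
qed

lemma has_distr_deriv_unique:
  assumes L: "L > 0" and "has_distr_deriv L u v1" "has_distr_deriv L u v2"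
    and v: "v1 absolutely_integrable_on {-L..L}" "v2 absolutely_integrable_on {-L..L}"
  shows "AE x in lebesgue_on (Omega L). v1 x = v2 x"
proof -
  have "\<exists>N. negligible N \<and> (\<forall>x\<in>Omega L - N. v1 x - v2 x = 0)"
  proof (rule fundamental_lemma_calculus_of_variations[OF L])
    show "(\<lambda>x. v1 x - v2 x) absolutely_integrable_on {-L..L}"
      using v by (intro set_integral_diff)
    fix \<phi> assume \<phi>: "\<phi> \<in> Cc_smooth (Omega L)"
    have i: "(\<lambda>x. v1 x * \<phi> x) absolutely_integrable_on {-L..L}" "(\<lambda>x. v2 x * \<phi> x) absolutely_integrable_on {-L..L}"
      using v Cc_smooth_primitive(4)[OF L \<phi>] by (auto intro: absolutely_integrable_smooth_mult)
    have "(LINT x|lebesgue_on (Omega L). v1 x * \<phi> x) = (LINT x|lebesgue_on (Omega L). v2 x * \<phi> x)"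
      using assms(2,3) \<phi> unfolding has_distr_deriv_def by fastforce
    hence "integral {-L..L} (\<lambda>x. v1 x * \<phi> x) - integral {-L..L} (\<lambda>x. v2 x * \<phi> x) = 0"
      using LINT_Omega[OF i(1)] LINT_Omega[OF i(2)] by simp
    thus "integral {-L..L} (\<lambda>x. (v1 x - v2 x) * \<phi> x) = 0"
      using i by (simp add: left_diff_distrib Henstock_Kurzweil_Integration.integral_diff
          absolutely_integrable_on_def)
  qed
  thus ?thesis unfolding AE_Omega_iff by simp
qed

text \<open>
  The difference of \<open>u\<close> and a primitive of \<open>v\<close> is orthogonal to the derivatives of all test functions,
  so it is constant by du Bois-Reymond.
\<close>

lemma has_distr_deriv_imp_primitive:
  assumes L: "L > 0" and u: "u \<in> L2 L" and v: "v \<in> L2 L" and d: "has_distr_deriv L u v"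
  shows "\<exists>u'. primitive_on (-L) L u' v \<and> (AE x in lebesgue_on (Omega L). u x = u' x)"
proof -
  define P where "P = (\<lambda>x. integral {-L..x} v)"
  have P: "primitive_on (-L) L P v"
    by (rule primitive_onI[where c = 0]) (use L2_absolutely_integrable[OF v] in \<open>auto simp: P_def\<close>)
  have le: "-L \<le> L" using L by simp
  have "\<exists>c N. negligible N \<and> (\<forall>x\<in>Omega L - N. u x - P x = c)"
  proof (rule du_Bois_Reymond[OF L])
    show "(\<lambda>x. u x - P x) absolutely_integrable_on {-L..L}"
      by (intro set_integral_diff L2_absolutely_integrable u L2_continuous primitive_continuous_on[OF P])
    fix \<phi> assume \<phi>: "\<phi> \<in> Cc_smooth (Omega L)"
    note q = Cc_smooth_primitive[OF L \<phi>]
    note bp = primitive_by_parts[OF P q(1) le]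
    have i: "(\<lambda>x. u x * deriv \<phi> x) absolutely_integrable_on {-L..L}"
      by (intro absolutely_integrable_smooth_mult smooth_deriv q L2_absolutely_integrable u)
    have "integral {-L..L} (\<lambda>x. u x * deriv \<phi> x) = - integral {-L..L} (\<lambda>x. v x * \<phi> x)"
      using d \<phi> LINT_Omega[OF i] LINT_Omega[OF bp(2)] by (simp add: has_distr_deriv_def)
    also have "\<dots> = integral {-L..L} (\<lambda>x. P x * deriv \<phi> x)"
      using bp(3) q(2,3) by simp
    finally show "integral {-L..L} (\<lambda>x. (u x - P x) * deriv \<phi> x) = 0"
      using i bp(1) by (simp add: left_diff_distrib Henstock_Kurzweil_Integration.integral_diff
          absolutely_integrable_on_def)
  qed
  then obtain c N where N: "negligible N" "\<And>x. x \<in> Omega L - N \<Longrightarrow> u x - P x = c" by blast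
  have "primitive_on (-L) L (\<lambda>x. c + P x) (\<lambda>x. 0 + v x)" by (rule primitive_add[OF primitive_const P])
  hence "primitive_on (-L) L (\<lambda>x. c + P x) v" by simp
  moreover have "AE x in lebesgue_on (Omega L). u x = c + P x"
    unfolding AE_Omega_iff using N by (intro exI[of _ N]) (auto simp: diff_eq_eq)
  ultimately show ?thesis by blast
qed

lemma H1_deriv:
  assumes "u \<in> H1 L"
  shows "distr_deriv L u \<in> L2 L" "has_distr_deriv L u (distr_deriv L u)"
proof -
  have "\<exists>v. v \<in> L2 L \<and> has_distr_deriv L u v" using assms by (auto simp: H1_def)
  hence "distr_deriv L u \<in> L2 L \<and> has_distr_deriv L u (distr_deriv L u)"
    unfolding distr_deriv_def by (rule someI_ex)
  thus "distr_deriv L u \<in> L2 L" "has_distr_deriv L u (distr_deriv L u)" by auto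
qed

lemma H1_L2: "u \<in> H1 L \<Longrightarrow> u \<in> L2 L"
  by (simp add: H1_def)

lemma H1_primitive:
  assumes "L > 0" "u \<in> H1 L"
  obtains u' where "primitive_on (-L) L u' (distr_deriv L u)" "AE x in lebesgue_on (Omega L). u x = u' x"
  using has_distr_deriv_imp_primitive[OF assms(1) H1_L2[OF assms(2)] H1_deriv[OF assms(2)]] by blast

lemma H1I:
  assumes L: "L > 0" and p: "primitive_on (-L) L u' v" and v: "v \<in> L2 L"
    and u: "u \<in> borel_measurable (lebesgue_on (Omega L))"
    and ae: "AE x in lebesgue_on (Omega L). u x = u' x"
  shows "u \<in> H1 L" "AE x in lebesgue_on (Omega L). distr_deriv L u x = v x"
proof -
  have d: "has_distr_deriv L u v" by (rule has_distr_deriv_primitive[OF L p u ae])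
  have "u \<in> L2 L" by (rule L2_AE_cong[OF L2_continuous[OF primitive_continuous_on[OF p]] u ae])
  thus h: "u \<in> H1 L" using d v by (auto simp: H1_def)
  show "AE x in lebesgue_on (Omega L). distr_deriv L u x = v x"
    using H1_deriv[OF h] d v
    by (intro has_distr_deriv_unique[OF L]) (auto intro: L2_absolutely_integrable)
qed

lemma H1I_primitive:
  assumes "L > 0" "primitive_on (-L) L u v" "v \<in> L2 L"
  shows "u \<in> H1 L" "u \<in> H1_cont L" "AE x in lebesgue_on (Omega L). distr_deriv L u x = v x"
  using H1I[OF assms continuous_measurable_Omega[OF primitive_continuous_on[OF assms(2)]]]
    primitive_continuous_on[OF assms(2)] by (auto simp: H1_cont_def)

text \<open>
  Two continuous functions that agree almost everywhere agree on a dense set, hence everywhere,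
  including the end points.
\<close>

lemma H1_cont_primitive:
  assumes L: "L > 0" and u: "u \<in> H1_cont L"
  shows "primitive_on (-L) L u (distr_deriv L u)"
proof -
  have h: "u \<in> H1 L" and cu: "continuous_on {-L..L} u" using u by (auto simp: H1_cont_def)
  obtain u' where p: "primitive_on (-L) L u' (distr_deriv L u)" and ae: "AE x in lebesgue_on (Omega L). u x = u' x"
    using H1_primitive[OF L h] by blast
  have cd: "continuous_on {-L..L} (\<lambda>x. u x - u' x)"
    by (intro continuous_intros cu primitive_continuous_on[OF p])
  obtain N where N: "negligible N" "\<And>x. x \<in> Omega L - N \<Longrightarrow> u x = u' x"
    using ae unfolding AE_Omega_iff by blast
  define S where "S = Omega L \<inter> (\<lambda>x. u x - u' x) -` (- {0})"
  have "open S" unfolding S_def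
    by (intro continuous_open_preimage continuous_on_subset[OF cd]) auto
  moreover have "S \<subseteq> N" using N(2) by (auto simp: S_def)
  ultimately have "S = {}" using N(1) negligible_subset open_not_negligible by blast
  hence "u x - u' x = 0" if "x \<in> Omega L" for x using that by (auto simp: S_def)
  hence "u x - u' x = 0" if "x \<in> {-L..L}" for x
    using continuous_constant_on_closure[of "Omega L" "\<lambda>x. u x - u' x" 0 x] cd L that by simp
  thus ?thesis using p by (auto intro: primitive_cong)
qed

text \<open>
  The boundary terms vanish because of \<open>p\<close> alone; \<open>z\<close> may have arbitrary boundary values.
\<close>

lemma H1_by_parts:
  assumes L: "L > 0" and z: "z \<in> H1 L" and p: "primitive_on (-L) L p q" "q \<in> L2 L" and b: "p (-L) = 0" "p L = 0"
  shows "(LINT x|lebesgue_on (Omega L). z x * q x) = - (LINT x|lebesgue_on (Omega L). distr_deriv L z x * p x)"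
proof -
  obtain z' where z': "primitive_on (-L) L z' (distr_deriv L z)" and ae: "AE x in lebesgue_on (Omega L). z x = z' x"
    using H1_primitive[OF L z] by blast
  have le: "-L \<le> L" using L by simp
  note bp = primitive_by_parts[OF z' p(1) le]
  have "(LINT x|lebesgue_on (Omega L). z x * q x) = (LINT x|lebesgue_on (Omega L). z' x * q x)"
  proof (rule integral_cong_AE)
    show "(\<lambda>x. z x * q x) \<in> borel_measurable (lebesgue_on (Omega L))"
      "(\<lambda>x. z' x * q x) \<in> borel_measurable (lebesgue_on (Omega L))"
      using L2_measurable[OF H1_L2[OF z]] L2_measurable[OF p(2)]
        continuous_measurable_Omega[OF primitive_continuous_on[OF z']] by auto
    show "AE x in lebesgue_on (Omega L). z x * q x = z' x * q x"
      using ae by eventually_elim simp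
  qed
  thus ?thesis using bp LINT_Omega[OF bp(1)] LINT_Omega[OF bp(2)] b by simp
qed

lemma primitive_L2_abs:
  assumes "primitive_on (-L) L u v" "v \<in> L2 L"
  shows "(\<lambda>x. sgn (u x) * v x) \<in> L2 L"
proof (rule L2_bounded_mult[where C = 1])
  show "(\<lambda>x. sgn (u x)) \<in> borel_measurable (lebesgue_on (Omega L))"
    using continuous_measurable_Omega[OF primitive_continuous_on[OF assms(1)]] by measurable
qed (use assms in \<open>auto simp: sgn_if\<close>)

text \<open>
  The maximum is half of \<open>u + p + |u - p|\<close>.
\<close>

lemma primitive_max:
  assumes "primitive_on (-L) L u v" "v \<in> L2 L" "primitive_on (-L) L p q" "q \<in> L2 L"
  shows "\<exists>s\<in>L2 L. primitive_on (-L) L (\<lambda>x. max (u x) (p x)) s"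
proof -
  have d: "primitive_on (-L) L (\<lambda>x. u x - p x) (\<lambda>x. v x - q x)" "(\<lambda>x. v x - q x) \<in> L2 L"
    using assms by (auto intro: primitive_minus L2_diff)
  have "primitive_on (-L) L (\<lambda>x. 1/2 * ((u x + p x) + \<bar>u x - p x\<bar>))
     (\<lambda>x. 1/2 * ((v x + q x) + sgn (u x - p x) * (v x - q x)))"
    by (rule primitive_cmult[OF primitive_add[OF primitive_add[OF assms(1,3)] primitive_abs[OF d(1)]]])
  hence "primitive_on (-L) L (\<lambda>x. max (u x) (p x)) (\<lambda>x. 1/2 * ((v x + q x) + sgn (u x - p x) * (v x - q x)))"
    by (rule primitive_cong) (auto simp: max_def abs_if field_simps)
  moreover have "(\<lambda>x. 1/2 * ((v x + q x) + sgn (u x - p x) * (v x - q x))) \<in> L2 L"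
    by (rule L2_cmult[OF L2_add[OF L2_add[OF assms(2,4)] primitive_L2_abs[OF d]]])
  ultimately show ?thesis by blast
qed

lemma primitive_uminus: "primitive_on a b u v \<Longrightarrow> primitive_on a b (\<lambda>x. - u x) (\<lambda>x. - v x)"
  using primitive_cmult[of a b u v "-1"] by simp

lemma primitive_min:
  assumes "primitive_on (-L) L u v" "v \<in> L2 L" "primitive_on (-L) L p q" "q \<in> L2 L"
  shows "\<exists>s\<in>L2 L. primitive_on (-L) L (\<lambda>x. min (u x) (p x)) s"
proof -
  obtain s where s: "s \<in> L2 L" "primitive_on (-L) L (\<lambda>x. max (- u x) (- p x)) s"
    using primitive_max[OF primitive_uminus[OF assms(1)] L2_uminus[OF assms(2)]
        primitive_uminus[OF assms(3)] L2_uminus[OF assms(4)]] by blast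
  have "primitive_on (-L) L (\<lambda>x. min (u x) (p x)) (\<lambda>x. - s x)"
    by (rule primitive_cong[OF primitive_uminus[OF s(2)]]) (auto simp: max_def min_def)
  thus ?thesis using L2_uminus[OF s(1)] by blast
qed

section \<open>Bounds for the weighted total variation\<close>

lemma LINT_deriv_cong:
  assumes "AE x in lebesgue_on (Omega L). d x = d' x" "z \<in> L2 L" "d \<in> L2 L" "d' \<in> L2 L"
  shows "(LINT x|lebesgue_on (Omega L). z x * d x) = (LINT x|lebesgue_on (Omega L). z x * d' x)"
proof (rule integral_cong_AE)
  show "AE x in lebesgue_on (Omega L). z x * d x = z x * d' x"
    using assms(1) by eventually_elim simp
qed (use assms in \<open>auto simp: L2_def\<close>)

lemma Cc_eq_0_outside:
  assumes "\<phi> \<in> Cc (Omega L)" "x \<notin> Omega L"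
  shows "\<phi> x = 0"
  using assms closure_subset[of "{x. \<phi> x \<noteq> 0}"] by (auto simp: Cc_def)

text \<open>
  Integration by parts moves the derivative from the competitor \<open>\<phi>\<close> to \<open>z\<close>, and \<open>|\<phi>| \<le> \<alpha>\<close>.
\<close>

lemma V_fun_le:
  assumes L: "L > 0" and a: "continuous_on {-L..L} \<alpha>" and z: "z \<in> H1 L"
  shows "V_fun L \<alpha> z \<le> ereal (LINT x|lebesgue_on (Omega L). \<alpha> x * \<bar>distr_deriv L z x\<bar>)"
  unfolding V_fun_def
proof (rule SUP_least)
  fix \<phi> assume "\<phi> \<in> {\<phi> \<in> H1_cont L \<inter> Cc (Omega L). \<forall>x\<in>{-L..L}. \<bar>\<phi> x\<bar> \<le> \<alpha> x}"
  hence h: "\<phi> \<in> H1_cont L" and c: "\<phi> \<in> Cc (Omega L)" and b: "\<And>x. x \<in> {-L..L} \<Longrightarrow> \<bar>\<phi> x\<bar> \<le> \<alpha> x" by auto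
  have d: "distr_deriv L \<phi> \<in> L2 L" using h H1_deriv by (auto simp: H1_cont_def)
  have z2: "distr_deriv L z \<in> L2 L" using H1_deriv z by blast
  have "(LINT x|lebesgue_on (Omega L). z x * distr_deriv L \<phi> x)
      = - (LINT x|lebesgue_on (Omega L). distr_deriv L z x * \<phi> x)"
    by (rule H1_by_parts[OF L z H1_cont_primitive[OF L h] d]) (auto intro: Cc_eq_0_outside[OF c])
  also have "\<dots> = (LINT x|lebesgue_on (Omega L). - (distr_deriv L z x * \<phi> x))" by simp
  also have "\<dots> \<le> (LINT x|lebesgue_on (Omega L). \<alpha> x * \<bar>distr_deriv L z x\<bar>)"
  proof (rule integral_mono_AE)
    show "integrable (lebesgue_on (Omega L)) (\<lambda>x. - (distr_deriv L z x * \<phi> x))"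
      using h by (intro Bochner_Integration.integrable_minus L2_mult z2 H1_L2) (auto simp: H1_cont_def)
    show "integrable (lebesgue_on (Omega L)) (\<lambda>x. \<alpha> x * \<bar>distr_deriv L z x\<bar>)"
      by (intro L2_mult L2_continuous a L2_abs z2)
    show "AE x in lebesgue_on (Omega L). - (distr_deriv L z x * \<phi> x) \<le> \<alpha> x * \<bar>distr_deriv L z x\<bar>"
    proof (rule AE_I2)
      fix x assume "x \<in> space (lebesgue_on (Omega L))"
      hence "\<bar>\<phi> x\<bar> * \<bar>distr_deriv L z x\<bar> \<le> \<alpha> x * \<bar>distr_deriv L z x\<bar>"
        by (intro mult_right_mono b) auto
      moreover have "- (distr_deriv L z x * \<phi> x) \<le> \<bar>distr_deriv L z x * \<phi> x\<bar>" by simp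
      ultimately show "- (distr_deriv L z x * \<phi> x) \<le> \<alpha> x * \<bar>distr_deriv L z x\<bar>"
        by (simp add: abs_mult mult.commute)
    qed
  qed
  finally show "ereal (LINT x|lebesgue_on (Omega L). z x * distr_deriv L \<phi> x)
     \<le> ereal (LINT x|lebesgue_on (Omega L). \<alpha> x * \<bar>distr_deriv L z x\<bar>)" by simp
qed

lemma deriv_zero_on_zero_set:
  assumes L: "L > 0" and p: "primitive_on (-L) L u v" "v \<in> L2 L"
  shows "AE x in lebesgue_on (Omega L). u x = 0 \<longrightarrow> v x = 0"
proof -
  let ?w = "\<lambda>x. if u x = 0 then v x else 0"
  have w: "primitive_on (-L) L (\<lambda>x. 0) ?w" by (rule primitive_zero_set[OF p(1)])
  have d: "has_distr_deriv L (\<lambda>x. 0) ?w" "has_distr_deriv L (\<lambda>x. 0) (\<lambda>x. 0)"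
    using has_distr_deriv_primitive[OF L w, of "\<lambda>x. 0"] has_distr_deriv_primitive[OF L primitive_const, of "\<lambda>x. 0" 0] by auto
  have "AE x in lebesgue_on (Omega L). ?w x = 0"
    by (rule has_distr_deriv_unique[OF L d primitive_absolutely_integrable[OF w]]) simp
  thus ?thesis by eventually_elim (simp split: if_splits)
qed

text \<open>
  The soft threshold: it moves \<open>t\<close> by \<open>e\<close> towards \<open>0\<close> and stops there. Writing it with absolute values
  gives the derivative of a composition from \<open>primitive_abs\<close>.
\<close>

definition shrink :: "real \<Rightarrow> real \<Rightarrow> real" where
  "shrink e t = t - 1/2 * (\<bar>t + e\<bar> - \<bar>t - e\<bar>)"

lemma shrink_bound: "e \<ge> 0 \<Longrightarrow> \<bar>shrink e t\<bar> \<le> \<bar>t\<bar>"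
  by (auto simp: shrink_def abs_if)

lemma shrink_eq_0: "\<bar>t\<bar> \<le> e \<Longrightarrow> shrink e t = 0"
  unfolding shrink_def using abs_of_nonneg[of "t + e"] abs_of_nonpos[of "t - e"] by (simp add: abs_le_iff)

text \<open>
  The competitors in the supremum have compact support, but \<open>\<sigma>\<close> only vanishes at the end points.
  Shrinking \<open>\<sigma>\<close> towards \<open>0\<close> by a small \<open>\<epsilon>\<close> cuts off a neighbourhood of the boundary and keeps the
  constraint \<open>|\<sigma>| \<le> \<alpha>\<close>; for a multiplicative cut-off the derivative would have to be
  controlled by Hardy's inequality. The derivatives
  of the shrunk functions converge to that of \<open>\<sigma>\<close> where \<open>\<sigma>\<close> does not vanish, and on the zero set
  of \<open>\<sigma>\<close> both are \<open>0\<close> almost everywhere.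
\<close>

lemma V_fun_ge:
  assumes L: "L > 0" and z: "z \<in> L2 L" and p: "primitive_on (-L) L \<sigma> s" "s \<in> L2 L"
    and b: "\<sigma> (-L) = 0" "\<sigma> L = 0" and bd: "\<And>x. x \<in> {-L..L} \<Longrightarrow> \<bar>\<sigma> x\<bar> \<le> \<alpha> x"
  shows "ereal (LINT x|lebesgue_on (Omega L). z x * s x) \<le> V_fun L \<alpha> z"
proof -
  define e where "e = (\<lambda>k::nat. 1 / real (Suc k))"
  have epos: "e k > 0" for k by (simp add: e_def)
  have elim: "e \<longlonglongrightarrow> 0" unfolding e_def
    using LIMSEQ_inverse_real_of_nat by (simp add: inverse_eq_divide)
  define t where "t = (\<lambda>k x. s x - 1/2 * (sgn (\<sigma> x + e k) * s x - sgn (\<sigma> x - e k) * s x))"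
  have sh: "primitive_on (-L) L (\<lambda>x. \<sigma> x + c) s" for c
    using primitive_add[OF p(1) primitive_const] by simp
  have sh': "primitive_on (-L) L (\<lambda>x. \<sigma> x - c) s" for c
    using sh[of "-c"] by simp
  have pt: "primitive_on (-L) L (\<lambda>x. shrink (e k) (\<sigma> x)) (t k)" for k
    unfolding shrink_def t_def
    by (rule primitive_minus[OF p(1) primitive_cmult[OF primitive_minus[OF primitive_abs[OF sh] primitive_abs[OF sh']]]])
  have t2: "t k \<in> L2 L" for k
    unfolding t_def
    by (rule L2_diff[OF p(2) L2_cmult[OF L2_diff[OF primitive_L2_abs[OF sh p(2)] primitive_L2_abs[OF sh' p(2)]]]])
  \<comment> \<open>Constant continuation of \<open>\<sigma>\<close>, since competitors are continuous functions on the whole line.\<close>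
  define ext where "ext = (\<lambda>x. \<sigma> (max (-L) (min L x)))"
  have cext: "continuous_on UNIV ext"
    unfolding ext_def
    by (rule continuous_on_compose2[OF primitive_continuous_on[OF p(1)]])
      (use L in \<open>auto intro!: continuous_intros\<close>)
  have ext_in: "ext x = \<sigma> x" if "x \<in> {-L..L}" for x
    using that by (simp add: ext_def min.absorb2 max.absorb2)
  have ext_out: "ext x = 0" if "x \<notin> Omega L" for x
    using that b L by (auto simp: ext_def min_def max_def not_less)
  define \<phi> where "\<phi> = (\<lambda>k x. shrink (e k) (ext x))"
  have p\<phi>: "primitive_on (-L) L (\<phi> k) (t k)" for k
    by (rule primitive_cong[OF pt]) (auto simp: \<phi>_def ext_in)
  note h = H1I_primitive[OF L p\<phi> t2]
  have "\<phi> k \<in> Cc (Omega L)" for k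
  proof -
    have c: "continuous_on UNIV (\<phi> k)"
      unfolding \<phi>_def shrink_def by (intro continuous_intros cext)
    let ?S = "{x. e k \<le> \<bar>ext x\<bar>}"
    have "closed ?S"
      by (intro closed_Collect_le continuous_intros cext)
    hence sub: "closure {x. \<phi> k x \<noteq> 0} \<subseteq> ?S"
    proof (rule closure_minimal[rotated])
      show "{x. \<phi> k x \<noteq> 0} \<subseteq> ?S" 
      proof
        fix x assume "x \<in> {x. \<phi> k x \<noteq> 0}"
        hence "\<not> \<bar>ext x\<bar> \<le> e k" using shrink_eq_0[of "ext x" "e k"] by (auto simp: \<phi>_def)
        thus "x \<in> ?S" by simp
      qed
    qed
    moreover have "?S \<subseteq> Omega L" using ext_out epos[of k] by force
    ultimately have "closure {x. \<phi> k x \<noteq> 0} \<subseteq> Omega L" by blast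
    moreover from this have "bounded (closure {x. \<phi> k x \<noteq> 0})"
      by (rule bounded_subset[rotated]) simp
    ultimately show ?thesis using c by (auto simp: Cc_def compact_eq_bounded_closed)
  qed
  moreover have "\<bar>\<phi> k x\<bar> \<le> \<alpha> x" if "x \<in> {-L..L}" for k x
    using shrink_bound[of "e k" "\<sigma> x"] epos[of k] bd[OF that] ext_in[OF that] by (simp add: \<phi>_def)
  ultimately have "ereal (LINT x|lebesgue_on (Omega L). z x * distr_deriv L (\<phi> k) x) \<le> V_fun L \<alpha> z" for k
    unfolding V_fun_def using h(2) by (intro SUP_upper) auto
  moreover have "(LINT x|lebesgue_on (Omega L). z x * distr_deriv L (\<phi> k) x) = (LINT x|lebesgue_on (Omega L). z x * t k x)" for k
    by (rule LINT_deriv_cong[OF h(3) z H1_deriv(1)[OF h(1)] t2])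
  ultimately have le: "ereal (LINT x|lebesgue_on (Omega L). z x * t k x) \<le> V_fun L \<alpha> z" for k by simp
  have "(\<lambda>k. LINT x|lebesgue_on (Omega L). z x * t k x) \<longlonglongrightarrow> (LINT x|lebesgue_on (Omega L). z x * s x)"
  proof (rule integral_dominated_convergence)
    show "(\<lambda>x. z x * s x) \<in> borel_measurable (lebesgue_on (Omega L))"
      "(\<lambda>x. z x * t k x) \<in> borel_measurable (lebesgue_on (Omega L))" for k
      using z p(2) t2[of k] by (auto simp: L2_def)
    show "integrable (lebesgue_on (Omega L)) (\<lambda>x. 2 * \<bar>z x * s x\<bar>)"
      using L2_mult[OF z p(2)] by simp
    show "AE x in lebesgue_on (Omega L). norm (z x * t k x) \<le> 2 * \<bar>z x * s x\<bar>" for k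
    proof (rule AE_I2)
      fix x
      have "\<bar>t k x\<bar> \<le> 2 * \<bar>s x\<bar>" by (auto simp: t_def sgn_if)
      hence "\<bar>z x\<bar> * \<bar>t k x\<bar> \<le> \<bar>z x\<bar> * (2 * \<bar>s x\<bar>)" by (rule mult_left_mono) simp
      thus "norm (z x * t k x) \<le> 2 * \<bar>z x * s x\<bar>" by (simp add: abs_mult)
    qed
    show "AE x in lebesgue_on (Omega L). (\<lambda>k. z x * t k x) \<longlonglongrightarrow> z x * s x"
      using deriv_zero_on_zero_set[OF L p]
    proof eventually_elim
      case (elim x)
      show ?case
      proof (cases "\<sigma> x = 0")
        case True
        thus ?thesis using elim by (simp add: t_def)
      next
        case False
        hence "\<forall>\<^sub>F k in sequentially. e k < \<bar>\<sigma> x\<bar>"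
          using order_tendstoD(2)[OF \<open>e \<longlonglongrightarrow> 0\<close>, of "\<bar>\<sigma> x\<bar>"] by simp
        hence "\<forall>\<^sub>F k in sequentially. z x * s x = z x * t k x"
        proof eventually_elim
          case (elim k)
          thus ?case using epos[of k] by (auto simp: t_def sgn_if abs_if split: if_splits)
        qed
        thus ?thesis by (rule Lim_transform_eventually[OF tendsto_const])
      qed
    qed
  qed
  hence "(\<lambda>k. ereal (LINT x|lebesgue_on (Omega L). z x * t k x)) \<longlonglongrightarrow> ereal (LINT x|lebesgue_on (Omega L). z x * s x)"
    by simp
  thus ?thesis by (rule LIMSEQ_le_const2) (use le in auto)
qed

lemma V_fun_nonneg:
  assumes L: "L > 0" and z: "z \<in> L2 L" and a: "\<And>x. x \<in> {-L..L} \<Longrightarrow> 0 \<le> \<alpha> x"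
  shows "0 \<le> V_fun L \<alpha> z"
  using V_fun_ge[OF L z primitive_const[of "-L" L 0] L2_const, of \<alpha>] a by (simp flip: zero_ereal_def)

text \<open>
  The derivative of a competitor has integral \<open>0\<close>.
\<close>

lemma V_fun_translate:
  assumes L: "L > 0" and z: "z \<in> L2 L"
  shows "V_fun L \<alpha> (\<lambda>x. z x + c) = V_fun L \<alpha> z"
  unfolding V_fun_def
proof (rule SUP_cong[OF refl])
  fix \<phi> assume "\<phi> \<in> {\<phi> \<in> H1_cont L \<inter> Cc (Omega L). \<forall>x\<in>{-L..L}. \<bar>\<phi> x\<bar> \<le> \<alpha> x}"
  hence h: "\<phi> \<in> H1_cont L" and k: "\<phi> \<in> Cc (Omega L)" by auto
  have d: "distr_deriv L \<phi> \<in> L2 L" using h H1_deriv by (auto simp: H1_cont_def)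
  have "(LINT x|lebesgue_on (Omega L). distr_deriv L \<phi> x) = \<phi> L - \<phi> (-L)"
    using primitive_diff[OF H1_cont_primitive[OF L h], of "-L" L] L
    by (simp add: LINT_Omega[OF L2_absolutely_integrable[OF d]])
  also have "\<dots> = 0" using Cc_eq_0_outside[OF k] by simp
  finally show "ereal (LINT x|lebesgue_on (Omega L). (z x + c) * distr_deriv L \<phi> x)
      = ereal (LINT x|lebesgue_on (Omega L). z x * distr_deriv L \<phi> x)"
    using L2_mult[OF z d] L2_integrable[OF d] by (simp add: distrib_right)
qed

section \<open>The decomposition of the subdifferential\<close>

lemma W_fun_H1:
  "z \<in> H1 L \<Longrightarrow> W_fun L \<beta> z = ereal (1 / 2 * (LINT x|lebesgue_on (Omega L). \<beta> x * (distr_deriv L z x)\<^sup>2))"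
  by (simp add: W_fun_def)

lemma W_fun_finite: "W_fun L \<beta> z < \<infinity> \<longleftrightarrow> z \<in> H1 L"
  by (simp add: W_fun_def)

lemma W_fun_deriv:
  assumes "z \<in> H1 L" "continuous_on {-L..L} \<beta>" "g \<in> L2 L"
    and ae: "AE x in lebesgue_on (Omega L). distr_deriv L z x = g x"
  shows "W_fun L \<beta> z = ereal (1 / 2 * (LINT x|lebesgue_on (Omega L). \<beta> x * (g x)\<^sup>2))"
proof -
  have "(LINT x|lebesgue_on (Omega L). \<beta> x * (distr_deriv L z x)\<^sup>2) = (LINT x|lebesgue_on (Omega L). \<beta> x * (g x)\<^sup>2)"
  proof (rule integral_cong_AE)
    show "(\<lambda>x. \<beta> x * (distr_deriv L z x)\<^sup>2) \<in> borel_measurable (lebesgue_on (Omega L))"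
      "(\<lambda>x. \<beta> x * (g x)\<^sup>2) \<in> borel_measurable (lebesgue_on (Omega L))"
      using continuous_measurable_Omega[OF assms(2)] L2_measurable[OF assms(3)]
        L2_measurable[OF H1_deriv(1)[OF assms(1)]] by auto
    show "AE x in lebesgue_on (Omega L). \<beta> x * (distr_deriv L z x)\<^sup>2 = \<beta> x * (g x)\<^sup>2"
      using ae by eventually_elim simp
  qed
  thus ?thesis using W_fun_H1[OF assms(1)] by simp
qed

lemma H1_translate:
  assumes L: "L > 0" and z: "z \<in> H1 L"
  shows "(\<lambda>x. z x + c) \<in> H1 L"
    "AE x in lebesgue_on (Omega L). distr_deriv L (\<lambda>x. z x + c) x = distr_deriv L z x"
proof -
  obtain z' where p: "primitive_on (-L) L z' (distr_deriv L z)" and ae: "AE x in lebesgue_on (Omega L). z x = z' x"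
    using H1_primitive[OF L z] by blast
  have p': "primitive_on (-L) L (\<lambda>x. z' x + c) (distr_deriv L z)"
    using primitive_add[OF p primitive_const] by simp
  have m: "(\<lambda>x. z x + c) \<in> borel_measurable (lebesgue_on (Omega L))"
    using L2_measurable[OF H1_L2[OF z]] by simp
  have ae': "AE x in lebesgue_on (Omega L). z x + c = z' x + c"
    using ae by eventually_elim simp
  show "(\<lambda>x. z x + c) \<in> H1 L"
    "AE x in lebesgue_on (Omega L). distr_deriv L (\<lambda>x. z x + c) x = distr_deriv L z x"
    by (rule H1I[OF L p' H1_deriv(1)[OF z] m ae'])+
qed

lemma L2_inner_diff:
  assumes "w \<in> L2 L" "z \<in> L2 L" "y \<in> L2 L"
  shows "L2_inner L w (\<lambda>x. z x - y x)
    = (LINT x|lebesgue_on (Omega L). z x * w x) - (LINT x|lebesgue_on (Omega L). y x * w x)"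
proof -
  have "L2_inner L w (\<lambda>x. z x - y x) = (LINT x|lebesgue_on (Omega L). z x * w x - y x * w x)"
    by (simp add: L2_inner_def algebra_simps)
  also have "\<dots> = (LINT x|lebesgue_on (Omega L). z x * w x) - (LINT x|lebesgue_on (Omega L). y x * w x)"
    by (intro Bochner_Integration.integral_diff L2_mult assms)
  finally show ?thesis .
qed

text \<open>
  The subgradient inequality in the direction of the constants \<open>1\<close> and \<open>-1\<close>, along which the
  functional does not change.
\<close>

lemma Phi_subdifferential_mean_zero:
  assumes L: "L > 0" and a: "\<And>x. x \<in> {-L..L} \<Longrightarrow> 0 \<le> \<alpha> x" and b: "continuous_on {-L..L} \<beta>"
    and sub: "(\<theta>, w) \<in> subdifferential L (Phi_fun L \<alpha> \<beta>)"
  shows "(LINT x|lebesgue_on (Omega L). w x) = 0"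
proof -
  have \<theta>: "\<theta> \<in> L2 L" and w: "w \<in> L2 L" and fin: "Phi_fun L \<alpha> \<beta> \<theta> < \<infinity>"
    and ineq: "\<And>z. z \<in> L2 L \<Longrightarrow> Phi_fun L \<alpha> \<beta> z < \<infinity> \<Longrightarrow>
      ereal (L2_inner L w (\<lambda>x. z x - \<theta> x)) \<le> Phi_fun L \<alpha> \<beta> z - Phi_fun L \<alpha> \<beta> \<theta>"
    using sub by (auto simp: subdifferential_def)
  have V0: "0 \<le> V_fun L \<alpha> \<theta>" by (rule V_fun_nonneg[OF L \<theta> a])
  have h: "\<theta> \<in> H1 L"
  proof (rule ccontr)
    assume "\<theta> \<notin> H1 L"
    thus False using fin V0 by (simp add: Phi_fun_def W_fun_def)
  qed
  obtain r where r: "Phi_fun L \<alpha> \<beta> \<theta> = ereal r"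
    using fin V0 by (cases "V_fun L \<alpha> \<theta>") (auto simp: Phi_fun_def W_fun_H1[OF h])
  have "c * (LINT x|lebesgue_on (Omega L). w x) \<le> 0" for c
  proof -
    have "Phi_fun L \<alpha> \<beta> (\<lambda>x. \<theta> x + c) = Phi_fun L \<alpha> \<beta> \<theta>"
      unfolding Phi_fun_def V_fun_translate[OF L \<theta>] W_fun_H1[OF h]
        W_fun_deriv[OF H1_translate(1)[OF L h] b H1_deriv(1)[OF h] H1_translate(2)[OF L h]] ..
    hence "ereal (L2_inner L w (\<lambda>x. (\<theta> x + c) - \<theta> x)) \<le> 0"
      using ineq[OF L2_add[OF \<theta> L2_const], of c] fin r by (simp add: zero_ereal_def)
    thus ?thesis by (simp add: L2_inner_def mult.commute)
  qed
  from this[of 1] this[of "-1"] show ?thesis by simp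
qed

text \<open>
  When \<open>t\<close> lies outside the interval from \<open>-a\<close> to \<open>a\<close>, its truncation is the end point on the side of
  the excess; otherwise the excess is \<open>0\<close>. Thus the truncation belongs to \<open>a Sgn\<close> of the excess.
\<close>

lemma clamp_complement:
  fixes t a :: real
  assumes "0 \<le> a"
  shows "max (-a) (min t a) * (t - max (-a) (min t a)) = a * \<bar>t - max (-a) (min t a)\<bar>"
  using assms by (auto simp: max_def min_def abs_if algebra_simps)

theorem mainTheorem1:
  fixes L :: real and \<alpha> \<beta> :: "real \<Rightarrow> real"
  assumes "0 < L"
    and "\<alpha> \<in> H1_cont L" and "\<beta> \<in> H1_cont L"
    and "(INF x\<in>{-L..L}. \<alpha> x) \<ge> 0" and "(INF x\<in>{-L..L}. \<beta> x) > 0"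
  shows "subdifferential L (Phi_fun L \<alpha> \<beta>) =
         op_sum (subdifferential L (V_fun L \<alpha>)) (subdifferential L (W_fun L \<beta>))"
proof -
  note L = assms(1)
  let ?M = "lebesgue_on (Omega L)"
  let ?D = "distr_deriv L"
  have c\<alpha>: "continuous_on {-L..L} \<alpha>" and c\<beta>: "continuous_on {-L..L} \<beta>"
    using assms by (auto simp: H1_cont_def)
  have INF_le: "(INF x\<in>{-L..L}. f x) \<le> f x" if "continuous_on {-L..L} f" "x \<in> {-L..L}"
    for f :: "real \<Rightarrow> real" and x
  proof (rule cINF_lower)
    show "bdd_below (f ` {-L..L})"
      using that by (intro bounded_imp_bdd_below compact_imp_bounded compact_continuous_image) auto
  qed fact
  have \<alpha>0: "0 \<le> \<alpha> x" if "x \<in> {-L..L}" for x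
    using INF_le[OF c\<alpha> that] assms(4) by linarith
  have \<beta>0: "0 < \<beta> x" if "x \<in> {-L..L}" for x
    using INF_le[OF c\<beta> that] assms(5) by linarith
  have V0: "0 \<le> V_fun L \<alpha> z" if "z \<in> L2 L" for z
    by (rule V_fun_nonneg[OF L that \<alpha>0])
  have fin: "z \<in> H1 L \<and> V_fun L \<alpha> z < \<infinity>" if "z \<in> L2 L" "Phi_fun L \<alpha> \<beta> z < \<infinity>" for z
    using that V0[OF that(1)] by (auto simp: Phi_fun_def W_fun_def split: if_splits)
  show ?thesis
  proof (intro equalityI subsetI)
    fix zw assume "zw \<in> op_sum (subdifferential L (V_fun L \<alpha>)) (subdifferential L (W_fun L \<beta>))"
    then obtain z a b where zw: "zw = (z, \<lambda>x. a x + b x)"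
      and a: "(z, a) \<in> subdifferential L (V_fun L \<alpha>)" and b: "(z, b) \<in> subdifferential L (W_fun L \<beta>)"
      by (auto simp: op_sum_def)
    have l2: "z \<in> L2 L" "a \<in> L2 L" "b \<in> L2 L" and fz: "V_fun L \<alpha> z < \<infinity>" "W_fun L \<beta> z < \<infinity>"
      using a b by (auto simp: subdifferential_def)
    have hz: "z \<in> H1 L" using fz(2) W_fun_finite by blast
    have "ereal (L2_inner L (\<lambda>x. a x + b x) (\<lambda>x. y x - z x)) \<le> Phi_fun L \<alpha> \<beta> y - Phi_fun L \<alpha> \<beta> z"
      if y: "y \<in> L2 L" "Phi_fun L \<alpha> \<beta> y < \<infinity>" for y
    proof -
      have hy: "y \<in> H1 L" and fy: "V_fun L \<alpha> y < \<infinity>" using fin[OF y] by auto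
      have d: "(\<lambda>x. y x - z x) \<in> L2 L" using y(1) l2(1) by (rule L2_diff)
      have "L2_inner L (\<lambda>x. a x + b x) (\<lambda>x. y x - z x)
          = L2_inner L a (\<lambda>x. y x - z x) + L2_inner L b (\<lambda>x. y x - z x)"
        unfolding L2_inner_def using L2_mult[OF l2(2) d] L2_mult[OF l2(3) d]
        by (simp add: distrib_right)
      moreover have "ereal (L2_inner L a (\<lambda>x. y x - z x)) \<le> V_fun L \<alpha> y - V_fun L \<alpha> z"
        using a y(1) fy by (auto simp: subdifferential_def)
      moreover have "ereal (L2_inner L b (\<lambda>x. y x - z x)) \<le> W_fun L \<beta> y - W_fun L \<beta> z"
        using b y(1) hy W_fun_finite by (auto simp: subdifferential_def)
      moreover obtain v1 v2 where "V_fun L \<alpha> y = ereal v1" "V_fun L \<alpha> z = ereal v2"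
        using fy fz V0[OF y(1)] V0[OF l2(1)] by (cases "V_fun L \<alpha> y"; cases "V_fun L \<alpha> z") auto
      ultimately show ?thesis
        by (simp add: Phi_fun_def W_fun_H1[OF hy] W_fun_H1[OF hz])
    qed
    moreover have "Phi_fun L \<alpha> \<beta> z < \<infinity>" using fz by (simp add: Phi_fun_def)
    ultimately show "zw \<in> subdifferential L (Phi_fun L \<alpha> \<beta>)"
      unfolding zw subdifferential_def using l2 L2_add by auto
  next
    fix zw assume "zw \<in> subdifferential L (Phi_fun L \<alpha> \<beta>)"
    then obtain \<theta> w where zw: "zw = (\<theta>, w)" and sub: "(\<theta>, w) \<in> subdifferential L (Phi_fun L \<alpha> \<beta>)"
      by (cases zw) auto
    have \<theta>: "\<theta> \<in> L2 L" and w: "w \<in> L2 L" and fin\<theta>: "Phi_fun L \<alpha> \<beta> \<theta> < \<infinity>"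
      and ineq: "\<And>z. z \<in> L2 L \<Longrightarrow> Phi_fun L \<alpha> \<beta> z < \<infinity> \<Longrightarrow>
        ereal (L2_inner L w (\<lambda>x. z x - \<theta> x)) \<le> Phi_fun L \<alpha> \<beta> z - Phi_fun L \<alpha> \<beta> \<theta>"
      using sub by (auto simp: subdifferential_def)
    have h\<theta>: "\<theta> \<in> H1 L" and V\<theta>: "V_fun L \<alpha> \<theta> < \<infinity>" using fin[OF \<theta> fin\<theta>] by auto
    have D\<theta>: "?D \<theta> \<in> L2 L" using H1_deriv(1)[OF h\<theta>] .

    \<comment> \<open>\<open>U\<close> plays the role of \<open>\<sigma> + \<beta> \<theta>'\<close>, whose derivative has to be \<open>-w\<close>.\<close>
    define U where "U = (\<lambda>x. integral {-L..x} (\<lambda>x. - w x))"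
    have nw: "(\<lambda>x. - w x) \<in> L2 L" by (rule L2_uminus[OF w])
    have pU: "primitive_on (-L) L U (\<lambda>x. - w x)"
      by (rule primitive_onI[where c = 0]) (use L2_absolutely_integrable[OF nw] in \<open>auto simp: U_def\<close>)
    have UL: "U (-L) = 0" "U L = 0"
      using Phi_subdifferential_mean_zero[OF L \<alpha>0 c\<beta> sub] LINT_Omega[OF L2_absolutely_integrable[OF nw]]
      by (auto simp: U_def)

    define \<sigma> where "\<sigma> = (\<lambda>x. max (- \<alpha> x) (min (U x) (\<alpha> x)))"
    note p\<alpha> = H1_cont_primitive[OF L assms(2)]
    have d\<alpha>: "?D \<alpha> \<in> L2 L" using assms(2) H1_deriv by (auto simp: H1_cont_def)
    obtain s where s: "s \<in> L2 L" and p\<sigma>: "primitive_on (-L) L \<sigma> s"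
      using primitive_min[OF pU nw p\<alpha> d\<alpha>] primitive_max[OF primitive_uminus[OF p\<alpha>] L2_uminus[OF d\<alpha>]]
      unfolding \<sigma>_def by blast
    have \<sigma>L: "\<sigma> (-L) = 0" "\<sigma> L = 0" using UL \<alpha>0[of L] \<alpha>0[of "-L"] L by (auto simp: \<sigma>_def)
    have \<sigma>\<alpha>: "\<bar>\<sigma> x\<bar> \<le> \<alpha> x" if "x \<in> {-L..L}" for x
      using \<alpha>0[OF that] by (auto simp: \<sigma>_def)
    have c\<sigma>: "continuous_on {-L..L} \<sigma>" by (rule primitive_continuous_on[OF p\<sigma>])

    define g where "g = (\<lambda>x. (U x - \<sigma> x) / \<beta> x)"
    have cg: "continuous_on {-L..L} g"
      unfolding g_def using \<beta>0
      by (intro continuous_intros primitive_continuous_on[OF pU] c\<sigma> c\<beta>) force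
    have g: "g \<in> L2 L" by (rule L2_continuous[OF cg])
    have \<beta>g: "\<beta> x * g x = U x - \<sigma> x" if "x \<in> {-L..L}" for x
      using \<beta>0[OF that] by (simp add: g_def)
    have \<sigma>g: "\<sigma> x * g x = \<alpha> x * \<bar>g x\<bar>" if "x \<in> {-L..L}" for x
      using clamp_complement[OF \<alpha>0[OF that], of "U x"] \<beta>0[OF that] by (simp add: g_def \<sigma>_def)
    \<comment> \<open>The candidate: a function with derivative \<open>g\<close>, for which the decomposition of \<open>w\<close> is explicit.\<close>
    define \<tau> where "\<tau> = (\<lambda>x. integral {-L..x} g)"
    have p\<tau>: "primitive_on (-L) L \<tau> g"
      by (rule primitive_onI[where c = 0]) (use L2_absolutely_integrable[OF g] in \<open>auto simp: \<tau>_def\<close>)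
    note h\<tau> = H1I_primitive[OF L p\<tau> g]
    have \<tau>: "\<tau> \<in> L2 L" by (rule H1_L2[OF h\<tau>(1)])

    have bp: "(LINT x|?M. z x * s x) = - (LINT x|?M. ?D z x * \<sigma> x)" if "z \<in> H1 L" for z
      by (rule H1_by_parts[OF L that p\<sigma> s \<sigma>L])
    have bw: "(LINT x|?M. z x * w x) = (LINT x|?M. ?D z x * U x)" if "z \<in> H1 L" for z
      using H1_by_parts[OF L that pU nw UL] by simp
    have Vge: "ereal (- (LINT x|?M. z x * s x)) \<le> V_fun L \<alpha> z" if "z \<in> L2 L" for z
      using V_fun_ge[OF L that primitive_uminus[OF p\<sigma>] L2_uminus[OF s], of \<alpha>] \<sigma>L \<sigma>\<alpha> by simp
    have Vle: "V_fun L \<alpha> z \<le> ereal (LINT x|?M. g x * \<sigma> x)"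
      if z: "z \<in> H1 L" "AE x in ?M. ?D z x = g x" for z
    proof -
      have "(LINT x|?M. \<alpha> x * \<bar>?D z x\<bar>) = (LINT x|?M. g x * \<sigma> x)"
      proof (rule integral_cong_AE)
        show "(\<lambda>x. \<alpha> x * \<bar>?D z x\<bar>) \<in> borel_measurable ?M" "(\<lambda>x. g x * \<sigma> x) \<in> borel_measurable ?M"
          using continuous_measurable_Omega[OF c\<alpha>] continuous_measurable_Omega[OF c\<sigma>]
            L2_measurable[OF g] L2_measurable[OF H1_deriv(1)[OF z(1)]] by auto
        show "AE x in ?M. \<alpha> x * \<bar>?D z x\<bar> = g x * \<sigma> x"
          using z(2) AE_space
        proof eventually_elim
          case (elim x)
          thus ?case using \<sigma>g[of x] by (simp add: mult.commute)
        qed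
      qed
      thus ?thesis using V_fun_le[OF L c\<alpha> z(1)] by simp
    qed
    have L2\<sigma>: "\<sigma> \<in> L2 L" and L2U: "U \<in> L2 L"
      by (intro L2_continuous c\<sigma> primitive_continuous_on[OF pU])+

    have D_eq_g: "AE x in ?M. ?D \<theta> x = g x"
    proof -
      let ?I = "\<lambda>f. LINT x|?M. f x"
      have V\<tau>: "V_fun L \<alpha> \<tau> \<le> ereal (?I (\<lambda>x. g x * \<sigma> x))" by (rule Vle[OF h\<tau>(1,3)])
      have W\<tau>: "W_fun L \<beta> \<tau> = ereal (1/2 * ?I (\<lambda>x. \<beta> x * (g x)\<^sup>2))"
        by (rule W_fun_deriv[OF h\<tau>(1) c\<beta> g h\<tau>(3)])
      have fin\<tau>: "Phi_fun L \<alpha> \<beta> \<tau> < \<infinity>"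
        using V\<tau> unfolding Phi_fun_def W\<tau> by (cases "V_fun L \<alpha> \<tau>") auto
      have inn: "L2_inner L w (\<lambda>x. \<tau> x - \<theta> x) = ?I (\<lambda>x. g x * U x) - ?I (\<lambda>x. ?D \<theta> x * U x)"
      proof -
        have "?I (\<lambda>x. ?D \<tau> x * U x) = ?I (\<lambda>x. g x * U x)"
          using LINT_deriv_cong[OF h\<tau>(3) L2U H1_deriv(1)[OF h\<tau>(1)] g] by (simp add: mult.commute)
        thus ?thesis
          unfolding L2_inner_diff[OF w \<tau> \<theta>] bw[OF h\<theta>] bw[OF h\<tau>(1)] by simp
      qed
      obtain v1 v2 where v: "V_fun L \<alpha> \<tau> = ereal v1" "V_fun L \<alpha> \<theta> = ereal v2"
        using V\<tau> V\<theta> V0[OF \<tau>] V0[OF \<theta>] by (cases "V_fun L \<alpha> \<tau>"; cases "V_fun L \<alpha> \<theta>") auto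
      have "v1 \<le> ?I (\<lambda>x. g x * \<sigma> x)" using V\<tau> v by simp
      moreover have "?I (\<lambda>x. ?D \<theta> x * \<sigma> x) \<le> v2" using Vge[OF \<theta>] bp[OF h\<theta>] v by simp
      moreover have "?I (\<lambda>x. g x * U x) - ?I (\<lambda>x. ?D \<theta> x * U x)
         \<le> v1 + 1/2 * ?I (\<lambda>x. \<beta> x * (g x)\<^sup>2) - (v2 + 1/2 * ?I (\<lambda>x. \<beta> x * (?D \<theta> x)\<^sup>2))"
        using ineq[OF \<tau> fin\<tau>] unfolding inn Phi_fun_def W\<tau> W_fun_H1[OF h\<theta>] v by simp
      ultimately have key: "?I (\<lambda>x. g x * U x) - ?I (\<lambda>x. ?D \<theta> x * U x) - ?I (\<lambda>x. g x * \<sigma> x) + ?I (\<lambda>x. ?D \<theta> x * \<sigma> x)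
         - 1/2 * ?I (\<lambda>x. \<beta> x * (g x)\<^sup>2) + 1/2 * ?I (\<lambda>x. \<beta> x * (?D \<theta> x)\<^sup>2) \<le> 0"
        by linarith
      have i\<beta>: "integrable ?M (\<lambda>x. \<beta> x * (f x)\<^sup>2)" if "f \<in> L2 L" for f
        using L2_mult[OF L2_continuous_mult[OF c\<beta> that] that] by (simp add: power2_eq_square mult.assoc)
      note ii = L2_mult[OF g L2U] L2_mult[OF D\<theta> L2U] L2_mult[OF g L2\<sigma>] L2_mult[OF D\<theta> L2\<sigma>] i\<beta>[OF g] i\<beta>[OF D\<theta>]
      \<comment> \<open>The integrand of the resulting inequality is the square completed in the claim \<open>q\<close>.\<close>
      let ?q = "\<lambda>x. g x * U x - ?D \<theta> x * U x - g x * \<sigma> x + ?D \<theta> x * \<sigma> x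
         - 1/2 * (\<beta> x * (g x)\<^sup>2) + 1/2 * (\<beta> x * (?D \<theta> x)\<^sup>2)"
      have iq: "integrable ?M ?q" using ii by simp
      have "?I ?q \<le> 0" using key ii by simp
      have q: "?q x = 1/2 * \<beta> x * (g x - ?D \<theta> x)\<^sup>2" if "x \<in> Omega L" for x
      proof -
        have U: "U x = \<sigma> x + \<beta> x * g x" using \<beta>g[of x] that by simp
        show ?thesis unfolding U by (simp add: power2_eq_square field_simps)
      qed
      have nn: "AE x in ?M. 0 \<le> ?q x"
      proof (rule AE_I2)
        fix x assume "x \<in> space ?M"
        hence x: "x \<in> Omega L" by simp
        show "0 \<le> ?q x" unfolding q[OF x] using \<beta>0[of x] x by simp
      qed
      hence "?I ?q = 0" using \<open>?I ?q \<le> 0\<close> integral_nonneg_AE[OF nn] by linarith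
      hence "AE x in ?M. ?q x = 0" using integral_nonneg_eq_0_iff_AE[OF iq nn] by blast
      thus ?thesis using AE_space
      proof eventually_elim
        case (elim x)
        hence x: "x \<in> Omega L" by simp
        show ?case using elim(1) \<beta>0[of x] x unfolding q[OF x] by simp
      qed
    qed

    define a where "a = (\<lambda>x. - s x)"
    define b where "b = (\<lambda>x. w x + s x)"
    have a: "a \<in> L2 L" unfolding a_def by (rule L2_uminus[OF s])
    have b: "b \<in> L2 L" unfolding b_def by (rule L2_add[OF w s])
    have "(\<theta>, a) \<in> subdifferential L (V_fun L \<alpha>)"
    proof -
      have "(LINT x|?M. ?D \<theta> x * \<sigma> x) = (LINT x|?M. g x * \<sigma> x)"
        using LINT_deriv_cong[OF D_eq_g L2\<sigma> D\<theta> g] by (simp add: mult.commute)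
      hence le: "V_fun L \<alpha> \<theta> \<le> ereal (- (LINT x|?M. \<theta> x * s x))"
        using Vle[OF h\<theta> D_eq_g] bp[OF h\<theta>] by simp
      have "ereal (L2_inner L a (\<lambda>x. z x - \<theta> x)) \<le> V_fun L \<alpha> z - V_fun L \<alpha> \<theta>"
        if z: "z \<in> L2 L" "V_fun L \<alpha> z < \<infinity>" for z
      proof -
        have i: "L2_inner L a (\<lambda>x. z x - \<theta> x) = - (LINT x|?M. z x * s x) + (LINT x|?M. \<theta> x * s x)"
          unfolding L2_inner_diff[OF a z(1) \<theta>] by (simp add: a_def)
        obtain v1 v2 where v: "V_fun L \<alpha> z = ereal v1" "V_fun L \<alpha> \<theta> = ereal v2"
          using z(2) V\<theta> V0[OF z(1)] V0[OF \<theta>] by (cases "V_fun L \<alpha> z"; cases "V_fun L \<alpha> \<theta>") auto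
        show ?thesis using Vge[OF z(1)] le unfolding i v by simp
      qed
      thus ?thesis using \<theta> a V\<theta> by (auto simp: subdifferential_def)
    qed
    moreover have "(\<theta>, b) \<in> subdifferential L (W_fun L \<beta>)"
    proof -
      define \<eta> where "\<eta> = (\<lambda>x. U x - \<sigma> x)"
      have p\<eta>: "primitive_on (-L) L \<eta> (\<lambda>x. - b x)"
        using primitive_minus[OF pU p\<sigma>] by (simp add: \<eta>_def b_def)
      have b\<eta>: "(LINT x|?M. z x * b x) = (LINT x|?M. ?D z x * \<eta> x)" if "z \<in> H1 L" for z
        using H1_by_parts[OF L that p\<eta> L2_uminus[OF b]] UL \<sigma>L by (simp add: \<eta>_def)
      have L2\<eta>: "\<eta> \<in> L2 L" by (rule L2_continuous[OF primitive_continuous_on[OF p\<eta>]])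
      have "ereal (L2_inner L b (\<lambda>x. z x - \<theta> x)) \<le> W_fun L \<beta> z - W_fun L \<beta> \<theta>"
        if "z \<in> L2 L" "W_fun L \<beta> z < \<infinity>" for z
      proof -
        have z: "z \<in> H1 L" using that W_fun_finite by blast
        have Dz: "?D z \<in> L2 L" by (rule H1_deriv(1)[OF z])
        have i\<beta>: "integrable ?M (\<lambda>x. \<beta> x * (f x)\<^sup>2)" if "f \<in> L2 L" for f
          using L2_mult[OF L2_continuous_mult[OF c\<beta> that] that] by (simp add: power2_eq_square mult.assoc)
        have "L2_inner L b (\<lambda>x. z x - \<theta> x) = (LINT x|?M. ?D z x * \<eta> x) - (LINT x|?M. ?D \<theta> x * \<eta> x)"
          unfolding L2_inner_diff[OF b \<open>z \<in> L2 L\<close> \<theta>] b\<eta>[OF z] b\<eta>[OF h\<theta>] ..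
        also have "\<dots> = (LINT x|?M. ?D z x * \<eta> x - ?D \<theta> x * \<eta> x)"
          by (intro Bochner_Integration.integral_diff[symmetric] L2_mult Dz D\<theta> L2\<eta>)
        also have "\<dots> \<le> (LINT x|?M. 1/2 * (\<beta> x * (?D z x)\<^sup>2) - 1/2 * (\<beta> x * (?D \<theta> x)\<^sup>2))"
        proof (rule integral_mono_AE)
          show "integrable ?M (\<lambda>x. ?D z x * \<eta> x - ?D \<theta> x * \<eta> x)"
            by (intro Bochner_Integration.integrable_diff L2_mult Dz D\<theta> L2\<eta>)
          show "integrable ?M (\<lambda>x. 1/2 * (\<beta> x * (?D z x)\<^sup>2) - 1/2 * (\<beta> x * (?D \<theta> x)\<^sup>2))"
            using i\<beta>[OF Dz] i\<beta>[OF D\<theta>] by simp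
          show "AE x in ?M. ?D z x * \<eta> x - ?D \<theta> x * \<eta> x \<le> 1/2 * (\<beta> x * (?D z x)\<^sup>2) - 1/2 * (\<beta> x * (?D \<theta> x)\<^sup>2)"
            using D_eq_g AE_space
          proof eventually_elim
            case (elim x)
            hence x: "x \<in> {-L..L}" by simp
            have \<eta>: "\<eta> x = \<beta> x * ?D \<theta> x" using \<beta>g[OF x] elim(1) by (simp add: \<eta>_def)
            have "0 \<le> \<beta> x * (?D z x - ?D \<theta> x)\<^sup>2" using \<beta>0[OF x] by simp
            thus ?case unfolding \<eta> by (simp add: power2_eq_square field_simps)
          qed
        qed
        also have "\<dots> = 1/2 * (LINT x|?M. \<beta> x * (?D z x)\<^sup>2) - 1/2 * (LINT x|?M. \<beta> x * (?D \<theta> x)\<^sup>2)"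
          using i\<beta>[OF Dz] i\<beta>[OF D\<theta>] by simp
        finally show ?thesis unfolding W_fun_H1[OF z] W_fun_H1[OF h\<theta>] by simp
      qed
      thus ?thesis using \<theta> b h\<theta> W_fun_finite by (auto simp: subdifferential_def)
    qed
    moreover have "w = (\<lambda>x. a x + b x)" by (simp add: a_def b_def)
    ultimately show "zw \<in> op_sum (subdifferential L (V_fun L \<alpha>)) (subdifferential L (W_fun L \<beta>))"
      unfolding zw op_sum_def by blast
  qed
qed

end
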